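(* Let $\mathcal{A}$ and $\mathcal{B}$ be unital $C^*$-algebras, let $\varPhi \colon \mathcal{A} \rightarrow \mathcal{B}$ be a unital positive linear map, let $a\in \mathcal{A}$ be selfadjoint, and let $p,q$ be positive integers such that $p<q$, $p$ is odd and $q$ is even. Then the following conditions are equivalent: (i) $\varPhi$ restricted to the unital subalgebra generated by $\{a\}$ is multiplicative; (ii) there exists a selfadjoint element $b\in \mathcal{B}$ such that $b^k = \varPhi(a^k)$ for $k=p$ and $k=q$. Moreover, if (ii) holds (with the element $b$), then $b=\varPhi(a)$.
   Context: A linear map $\varPhi\colon\mathcal{A}\to\mathcal{B}$ between unital $C^*$-algebras is positive if $\varPhi(c)\geqslant 0$ whenever $c\in\mathcal{A}$ and $c\geqslant 0$; it is unital if it maps the unit of $\mathcal{A}$ to the unit of $\mathcal{B}$. Algebras are over $\mathbb{C}$. *)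

theory Defs
  imports Complex_Main
begin

class scaleC =
  fixes scaleC :: "complex \<Rightarrow> 'a \<Rightarrow> 'a" (infixr "*\<^sub>C" 75)

class star =
  fixes star :: "'a \<Rightarrow> 'a"

text \<open>
  Unital complex C*-algebras.  The unit comes from \<^class>\<open>monoid_mult\<close> rather than
  from \<^class>\<open>real_normed_algebra_1\<close>, because the latter requires \<open>0 \<noteq> 1\<close>; the zero
  algebra is thus admitted, and \<open>norm 1 = 1\<close> follows from the C*-identity in every other
  algebra.  The axiom \<open>scaleR_scaleC\<close> only ties the real scalar multiplication carried by
  \<^class>\<open>banach\<close> to the complex one.
\<close>

class unital_cstar_algebra = banach + real_normed_algebra + monoid_mult + scaleC + star +
  assumes scaleR_scaleC: "r *\<^sub>R x = complex_of_real r *\<^sub>C x"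
    and scaleC_add_right: "z *\<^sub>C (x + y) = z *\<^sub>C x + z *\<^sub>C y"
    and scaleC_add_left: "(z + w) *\<^sub>C x = z *\<^sub>C x + w *\<^sub>C x"
    and scaleC_scaleC: "z *\<^sub>C (w *\<^sub>C x) = (z * w) *\<^sub>C x"
    and scaleC_one: "1 *\<^sub>C x = x"
    and mult_scaleC_left: "(z *\<^sub>C x) * y = z *\<^sub>C (x * y)"
    and mult_scaleC_right: "x * (z *\<^sub>C y) = z *\<^sub>C (x * y)"
    and norm_scaleC: "norm (z *\<^sub>C x) = cmod z * norm x"
    and star_star: "star (star x) = x"
    and star_add: "star (x + y) = star x + star y"
    and star_scaleC: "star (z *\<^sub>C x) = cnj z *\<^sub>C star x"
    and star_mult: "star (x * y) = star y * star x"
    and cstar_identity: "norm (star x * x) = (norm x)\<^sup>2"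

lemma vector_space_scaleC:
  "vector_space (scaleC :: complex \<Rightarrow> 'a \<Rightarrow> 'a::unital_cstar_algebra)"
  by unfold_locales
    (simp_all add: scaleC_add_right scaleC_add_left scaleC_scaleC scaleC_one)

abbreviation clinear :: "('a::unital_cstar_algebra \<Rightarrow> 'b::unital_cstar_algebra) \<Rightarrow> bool" where
  "clinear \<equiv> Vector_Spaces.linear scaleC scaleC"

definition selfadjoint :: "'a::unital_cstar_algebra \<Rightarrow> bool" where
  "selfadjoint x \<longleftrightarrow> star x = x"

definition alg_invertible :: "'a::unital_cstar_algebra \<Rightarrow> bool" where
  "alg_invertible x \<longleftrightarrow> (\<exists>y. x * y = 1 \<and> y * x = 1)"

definition alg_spectrum :: "'a::unital_cstar_algebra \<Rightarrow> complex set" where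
  "alg_spectrum x = {z. \<not> alg_invertible (z *\<^sub>C 1 - x)}"

definition positive_elem :: "'a::unital_cstar_algebra \<Rightarrow> bool" where
  "positive_elem c \<longleftrightarrow> selfadjoint c \<and> alg_spectrum c \<subseteq> complex_of_real ` {0..}"

definition positive_map :: "('a::unital_cstar_algebra \<Rightarrow> 'b::unital_cstar_algebra) \<Rightarrow> bool" where
  "positive_map \<Phi> \<longleftrightarrow> (\<forall>c. positive_elem c \<longrightarrow> positive_elem (\<Phi> c))"

definition unital_map :: "('a::unital_cstar_algebra \<Rightarrow> 'b::unital_cstar_algebra) \<Rightarrow> bool" where
  "unital_map \<Phi> \<longleftrightarrow> \<Phi> 1 = 1"

text \<open>
  Purely algebraic: neither closedness under \<^const>\<open>star\<close> nor norm-closedness is required.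
\<close>

definition unital_subalgebra :: "'a::unital_cstar_algebra set \<Rightarrow> bool" where
  "unital_subalgebra S \<longleftrightarrow>
     1 \<in> S \<and> (\<forall>x\<in>S. \<forall>y\<in>S. x + y \<in> S \<and> x * y \<in> S) \<and> (\<forall>z. \<forall>x\<in>S. z *\<^sub>C x \<in> S)"

definition multiplicative_on ::
  "'a::unital_cstar_algebra set \<Rightarrow> ('a \<Rightarrow> 'b::unital_cstar_algebra) \<Rightarrow> bool" where
  "multiplicative_on S \<Phi> \<longleftrightarrow> (\<forall>x\<in>S. \<forall>y\<in>S. \<Phi> (x * y) = \<Phi> x * \<Phi> y)"

end

theory Submission
  imports Defs "HOL-Analysis.Analysis" "HOL-Computational_Algebra.Fundamental_Theorem_Algebra"
begin

text \<open>
  Suppose \<open>b\<close> is selfadjoint with \<open>b\<^sup>k = \<Phi> (a\<^sup>k)\<close> for \<open>k = p\<close> and \<open>k = q\<close>.  For real \<open>\<nu> \<noteq> 0\<close> the polynomial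
  \<open>p x\<^sup>q / \<nu>\<^sup>q - q x\<^sup>p / \<nu>\<^sup>p + (q - p)\<close> is, in the variable \<open>x\<^sup>p\<close>, a convex
  function minus its tangent at \<open>x = \<nu>\<close>; this is where \<open>p\<close> odd and \<open>q\<close> even enter.
  So \<open>\<nu>\<^sup>2\<close> times it is comparable with \<open>(x - \<nu>)\<^sup>2\<close>: at least \<open>(x - \<nu>)\<^sup>2 / 4\<close>
  for all real \<open>x\<close>, and at most \<open>K (x - \<nu>)\<^sup>2\<close> for \<open>\<bar>x - \<nu>\<bar> \<le> 3 \<bar>\<nu>\<bar>\<close>.  Only the powers
  \<open>0\<close>, \<open>p\<close>, \<open>q\<close> of \<open>x\<close> occur, so \<open>\<Phi>\<close> maps its value at \<open>a\<close> to its
  value at \<open>b\<close>.  Positivity of \<open>\<Phi>\<close> thus bounds \<open>\<Phi> ((a - \<nu>)\<^sup>2)\<close> by a polynomial in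
  \<open>b\<close> that vanishes to second order at \<open>\<nu>\<close>.

  By Kadison's inequality, the element
  \<open>X = \<Phi> (a\<^sup>2) - b \<Phi> a - (\<Phi> a) b + b\<^sup>2\<close> is nonnegative and at most
  \<open>2 \<Phi> ((a - \<nu>)\<^sup>2) + 2 (b - \<nu>)\<^sup>2\<close>.  So near every spectral value \<open>\<nu> \<noteq> 0\<close> of
  \<open>b\<close>, \<open>X\<close> is quadratically small in the distance to \<open>\<nu>\<close>.  Cutting the spectrum of
  \<open>b\<close> into \<open>m\<close> pieces of length of order \<open>1 / m\<close>, the diagonal blocks of \<open>X\<close> are of
  order \<open>1 / m\<^sup>2\<close>, and since \<open>X\<close> is positive it is at most \<open>m\<close> times its block
  diagonal, hence of order \<open>1 / m\<close>.  Therefore \<open>X = 0\<close>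
  (\<open>eq_zero_if_locally_quadratically_small\<close>), which says \<open>\<Phi> a = b\<close> and
  \<open>\<Phi> (a\<^sup>2) = (\<Phi> a)\<^sup>2\<close> (\<open>two_moments_determine\<close>).  Equality in Kadison's inequality
  at \<open>a\<close> propagates to all powers of \<open>a\<close> by a first variation
  (\<open>map_power_if_map_square\<close>), and hence to the algebra that \<open>a\<close> generates.
  Conversely, if \<open>\<Phi>\<close> is multiplicative there, \<open>b = \<Phi> a\<close> has all moments \<open>b\<^sup>k = \<Phi> (a\<^sup>k)\<close>.

  The argument needs from C*-theory that the positive cone, defined by the spectrum, is a
  closed convex cone stable under \<open>x \<mapsto> f x f\<close> for selfadjoint \<open>f\<close>, and that real
  polynomials that are nonnegative on a symmetric interval of radius at least \<open>norm h\<close> take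
  positive values at a selfadjoint \<open>h\<close>.  The first rests on the fact that \<open>norm h\<close> or
  \<open>- norm h\<close> lies in the spectrum of a nonzero selfadjoint \<open>h\<close>, proved by squaring
  repeatedly (\<open>not_invertible_one_minus_square\<close>), the second on the factorization of complex
  polynomials.  Kadison's inequality follows by discretizing \<open>\<Phi>\<close> with Bernstein
  polynomials (\<open>kadison_shifted\<close>).
\<close>

section \<open>Scalars, involution and norm\<close>

lemma scaleC_zero_left [simp]: "0 *\<^sub>C x = (0::'a::unital_cstar_algebra)"
  using scaleC_add_left[of 0 0 x] by simp

lemma scaleC_zero_right [simp]: "z *\<^sub>C 0 = (0::'a::unital_cstar_algebra)"
  using scaleC_add_right[of z "0::'a" 0] by simp

lemma scaleC_minus_right: "z *\<^sub>C (- x) = - (z *\<^sub>C (x::'a::unital_cstar_algebra))"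
  using scaleC_add_right[of z x "- x"] by (simp add: eq_neg_iff_add_eq_0 add.commute)

lemma scaleC_minus_left: "(- z) *\<^sub>C x = - (z *\<^sub>C (x::'a::unital_cstar_algebra))"
  using scaleC_add_left[of z "- z" x] by (simp add: eq_neg_iff_add_eq_0 add.commute)

lemma scaleC_diff_right: "z *\<^sub>C (x - y) = z *\<^sub>C x - z *\<^sub>C (y::'a::unital_cstar_algebra)"
  using scaleC_add_right[of z x "- y"] by (simp add: scaleC_minus_right)

lemma star_zero [simp]: "star 0 = (0::'a::unital_cstar_algebra)"
  using star_add[of "0::'a" 0] by simp

lemma star_minus: "star (- x) = - star (x::'a::unital_cstar_algebra)"
  using star_add[of x "- x"] by (simp add: eq_neg_iff_add_eq_0 add.commute)

lemma star_diff: "star (x - y) = star x - star (y::'a::unital_cstar_algebra)"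
  using star_add[of x "- y"] by (simp add: star_minus)

lemma star_one [simp]: "star 1 = (1::'a::unital_cstar_algebra)"
  using star_mult[of "star 1" "1::'a"] by (simp add: star_star)

lemma star_scaleR: "star (r *\<^sub>R x) = r *\<^sub>R star (x::'a::unital_cstar_algebra)"
  by (simp add: scaleR_scaleC star_scaleC)

lemma star_power: "star (x ^ n) = star (x::'a::unital_cstar_algebra) ^ n"
  by (induction n) (simp_all add: star_mult power_commutes)

lemma norm_star: "norm (star x) = norm (x::'a::unital_cstar_algebra)"
proof -
  have le: "norm y \<le> norm (star y)" for y :: 'a
  proof (cases "y = 0")
    case False
    have "norm y * norm y \<le> norm (star y) * norm y"
      using cstar_identity[of y] norm_mult_ineq[of "star y" y] by (simp add: power2_eq_square)
    with False show ?thesis by simp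
  qed simp
  show ?thesis using le[of x] le[of "star x"] by (simp add: star_star)
qed

lemma norm_one_le: "norm (1::'a::unital_cstar_algebra) \<le> 1"
proof -
  have "norm (1::'a) = norm (1::'a) * norm (1::'a)"
    using cstar_identity[of "1::'a"] by (simp add: power2_eq_square)
  then show ?thesis by (cases "norm (1::'a) = 0") auto
qed

lemma norm_selfadjoint_square:
  "selfadjoint x \<Longrightarrow> norm (x * x) = (norm (x::'a::unital_cstar_algebra))\<^sup>2"
  using cstar_identity[of x] by (simp add: selfadjoint_def)

lemma tendsto_star:
  "(f \<longlongrightarrow> l) F \<Longrightarrow> ((\<lambda>n. star (f n :: 'a::unital_cstar_algebra)) \<longlongrightarrow> star l) F"
  unfolding tendsto_iff dist_norm by (simp flip: star_diff add: norm_star)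

lemma selfadjoint_intros [simp, intro]:
  fixes x y :: "'a::unital_cstar_algebra"
  shows "selfadjoint (0::'a)" "selfadjoint (1::'a)"
    and "selfadjoint x \<Longrightarrow> selfadjoint y \<Longrightarrow> selfadjoint (x + y)"
    and "selfadjoint x \<Longrightarrow> selfadjoint y \<Longrightarrow> selfadjoint (x - y)"
    and "selfadjoint x \<Longrightarrow> selfadjoint (- x)"
    and "selfadjoint x \<Longrightarrow> selfadjoint (r *\<^sub>R x)"
    and "selfadjoint x \<Longrightarrow> selfadjoint (x ^ n)"
    and "selfadjoint x \<Longrightarrow> selfadjoint (x * x)"
    and "selfadjoint x \<Longrightarrow> selfadjoint y \<Longrightarrow> selfadjoint (x * y * x)"
  by (simp_all add: selfadjoint_def star_add star_diff star_minus star_scaleR star_power star_mult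
      mult.assoc)

section \<open>Invertible elements and the spectrum of a selfadjoint element\<close>

lemma alg_invertible_mult:
  assumes "alg_invertible x" "alg_invertible (y::'a::unital_cstar_algebra)"
  shows "alg_invertible (x * y)"
proof -
  obtain u v where u: "x * u = 1" "u * x = 1" and v: "y * v = 1" "v * y = 1"
    using assms by (auto simp: alg_invertible_def)
  have "x * y * (v * u) = x * (y * v) * u" "v * u * (x * y) = v * (u * x) * y"
    by (simp_all add: mult.assoc)
  then show ?thesis using u v unfolding alg_invertible_def by (intro exI[of _ "v * u"]) simp
qed

lemma alg_invertible_one [simp]: "alg_invertible (1::'a::unital_cstar_algebra)"
  unfolding alg_invertible_def by (intro exI[of _ 1]) simp

lemma alg_invertible_scaleC_iff:
  "z \<noteq> 0 \<Longrightarrow> alg_invertible (z *\<^sub>C x) \<longleftrightarrow> alg_invertible (x::'a::unital_cstar_algebra)"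
proof -
  have *: "alg_invertible (w *\<^sub>C y)" if wy: "w \<noteq> 0" "alg_invertible y" for w and y :: 'a
  proof -
    obtain v where v: "y * v = 1" "v * y = 1" using wy(2) by (auto simp: alg_invertible_def)
    then show ?thesis unfolding alg_invertible_def using wy(1)
      by (intro exI[of _ "inverse w *\<^sub>C v"])
        (simp add: mult_scaleC_left mult_scaleC_right scaleC_scaleC scaleC_one)
  qed
  assume "z \<noteq> 0"
  then show ?thesis using *[of z x] *[of "inverse z" "z *\<^sub>C x"]
    by (auto simp: scaleC_scaleC scaleC_one)
qed

lemma alg_invertible_scaleR_iff:
  "r \<noteq> 0 \<Longrightarrow> alg_invertible (r *\<^sub>R x) \<longleftrightarrow> alg_invertible (x::'a::unital_cstar_algebra)"
  by (simp add: scaleR_scaleC alg_invertible_scaleC_iff)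

lemma alg_invertible_minus_iff:
  "alg_invertible (- x) \<longleftrightarrow> alg_invertible (x::'a::unital_cstar_algebra)"
  using alg_invertible_scaleR_iff[of "-1" x] by simp

lemma alg_invertible_diff_commute:
  "alg_invertible (x - y) \<longleftrightarrow> alg_invertible (y - (x::'a::unital_cstar_algebra))"
  using alg_invertible_minus_iff[of "x - y"] by simp

lemma norm_power_le: "norm (x ^ n) \<le> norm (x::'a::unital_cstar_algebra) ^ n"
proof (induction n)
  case (Suc n)
  then show ?case
    using norm_mult_ineq[of x "x ^ n"] mult_left_mono[OF Suc, of "norm x"] by simp
qed (simp add: norm_one_le)

text \<open>The inverse is the Neumann series.\<close>

lemma alg_invertible_one_minus:
  assumes "norm (x::'a::unital_cstar_algebra) < 1"
  shows "alg_invertible (1 - x)"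
proof -
  have sm: "summable (\<lambda>n. x ^ n)"
    by (rule summable_comparison_test[of _ "\<lambda>n. norm x ^ n"])
      (use assms norm_power_le in \<open>auto intro!: exI[of _ 0] summable_geometric\<close>)
  have sh: "(\<lambda>n. x ^ Suc n) sums (suminf (\<lambda>n. x ^ n) - 1)"
    using sums_split_initial_segment[OF summable_sums[OF sm], of 1] by simp
  have "(\<lambda>n. x * x ^ n) sums (x * suminf (\<lambda>n. x ^ n))"
    by (rule bounded_linear.sums[OF bounded_linear_mult_right summable_sums[OF sm]])
  with sh have r: "x * suminf (\<lambda>n. x ^ n) = suminf (\<lambda>n. x ^ n) - 1"
    by (auto intro: sums_unique2)
  have "(\<lambda>n. x ^ n * x) sums (suminf (\<lambda>n. x ^ n) * x)"
    by (rule bounded_linear.sums[OF bounded_linear_mult_left summable_sums[OF sm]])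
  with sh have l: "suminf (\<lambda>n. x ^ n) * x = suminf (\<lambda>n. x ^ n) - 1"
    by (auto intro: sums_unique2 simp: power_commutes)
  show ?thesis unfolding alg_invertible_def
    using r l by (intro exI[of _ "suminf (\<lambda>n. x ^ n)"]) (simp add: algebra_simps)
qed

lemma alg_invertible_if_norm_less:
  assumes "norm (x::'a::unital_cstar_algebra) < cmod z"
  shows "alg_invertible (z *\<^sub>C 1 - x)"
proof -
  have z: "z \<noteq> 0" using assms by auto
  have "norm (inverse z *\<^sub>C x) < 1" using assms z
    by (simp add: norm_scaleC norm_inverse) (simp add: field_simps)
  then have "alg_invertible (z *\<^sub>C (1 - inverse z *\<^sub>C x))"
    using z alg_invertible_one_minus by (simp add: alg_invertible_scaleC_iff)
  moreover have "z *\<^sub>C (1 - inverse z *\<^sub>C x) + z *\<^sub>C (inverse z *\<^sub>C x) = z *\<^sub>C 1"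
    by (simp flip: scaleC_add_right)
  then have "z *\<^sub>C (1 - inverse z *\<^sub>C x) = z *\<^sub>C 1 - x"
    using z by (simp add: scaleC_scaleC scaleC_one eq_diff_eq)
  ultimately show ?thesis by simp
qed

lemma alg_invertible_real_if_norm_less:
  "norm (x::'a::unital_cstar_algebra) < \<bar>r\<bar> \<Longrightarrow> alg_invertible (r *\<^sub>R 1 - x)"
  using alg_invertible_if_norm_less[of x "complex_of_real r"] by (simp add: scaleR_scaleC)

text \<open>
  Arens' trick: adding \<open>i t\<close> to \<open>h\<close> moves a spectral value with imaginary part \<open>\<beta>\<close> to one with
  imaginary part \<open>\<beta> + t\<close>, while the C*-identity gives \<open>norm (h + i t)\<^sup>2 \<le> norm h\<^sup>2 + t\<^sup>2\<close>;
  for large \<open>t\<close> of the sign of \<open>\<beta>\<close> this is only compatible with \<open>\<beta> = 0\<close>.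
\<close>

lemma alg_invertible_nonreal:
  assumes h: "selfadjoint (h::'a::unital_cstar_algebra)" and z: "Im z \<noteq> 0"
  shows "alg_invertible (z *\<^sub>C 1 - h)"
proof -
  define \<beta> where "\<beta> = Im z"
  define t where "t = ((norm h)\<^sup>2 + 1) / (2 * \<beta>)"
  define y where "y = h + (\<i> * of_real t) *\<^sub>C 1"
  have sy: "star y = h - (\<i> * of_real t) *\<^sub>C 1"
  proof -
    have "star y = h + (- (\<i> * of_real t)) *\<^sub>C 1"
      using h by (simp add: y_def selfadjoint_def star_add star_scaleC)
    moreover have "(- (\<i> * of_real t)) *\<^sub>C 1 + (\<i> * of_real t) *\<^sub>C (1::'a) = 0"
      by (simp flip: scaleC_add_left)
    ultimately show ?thesis by (simp add: eq_diff_eq add.assoc)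
  qed
  have "star y * y = h * h - (\<i> * of_real t) *\<^sub>C ((\<i> * of_real t) *\<^sub>C 1)"
    unfolding sy unfolding y_def
    by (simp add: algebra_simps mult_scaleC_left mult_scaleC_right scaleC_diff_right)
  also have "\<dots> = h * h - (- (t\<^sup>2)) *\<^sub>R 1"
    by (simp add: scaleC_scaleC scaleR_scaleC power2_eq_square mult.assoc mult.left_commute
        del: scaleR_minus_left)
  finally have "star y * y = h * h + (t\<^sup>2) *\<^sub>R 1" by simp
  then have "(norm y)\<^sup>2 \<le> norm (h * h) + norm ((t\<^sup>2) *\<^sub>R (1::'a))"
    using cstar_identity[of y] norm_triangle_ineq by metis
  also have "\<dots> \<le> (norm h)\<^sup>2 + t\<^sup>2"
    using norm_mult_ineq[of h h] mult_left_mono[OF norm_one_le[where 'a='a], of "t\<^sup>2"]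
    by (simp add: power2_eq_square)
  also have "\<dots> < (Re z)\<^sup>2 + (\<beta> + t)\<^sup>2"
  proof -
    have "2 * \<beta> * t = (norm h)\<^sup>2 + 1" using z by (simp add: t_def \<beta>_def)
    then show ?thesis by (simp add: power2_sum add_pos_nonneg add_strict_increasing2 add.commute)
  qed
  also have "\<dots> = (cmod (z + \<i> * of_real t))\<^sup>2"
    by (simp add: cmod_power2 \<beta>_def)
  finally have "norm y < cmod (z + \<i> * of_real t)"
    by (simp add: power2_less_imp_less)
  from alg_invertible_if_norm_less[OF this] show ?thesis
    by (simp add: y_def scaleC_add_left)
qed

section \<open>The spectral radius of a selfadjoint element\<close>

text \<open>
  On scalars this says \<open>x / (1 + x) \<le> 1/2\<close> for \<open>0 \<le> x = g\<^sup>2 \<le> 1\<close>.  The Cayley transform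
  \<open>u = (1 - i g) (1 + i g)\<^sup>-\<^sup>1\<close> is unitary, and the inverse \<open>w\<close> of \<open>1 + g\<^sup>2\<close>
  satisfies \<open>16 (w - w\<^sup>2) = 2 - u\<^sup>2 - (star u)\<^sup>2\<close>, which has norm at most \<open>4\<close>.
  Now \<open>c = g\<^sup>2 w = 1 - w\<close> has \<open>c\<^sup>2 = g\<^sup>2 (w - w\<^sup>2)\<close>, and the C*-identity bounds \<open>c\<close>.
\<close>

lemma inverse_one_plus_square:
  assumes g: "selfadjoint (g::'a::unital_cstar_algebra)" and le: "norm g \<le> 1"
  obtains w where "w * (1 + g * g) = 1" "(1 + g * g) * w = 1" "norm (1 - w) \<le> 1/2"
proof -
  define G where "G = \<i> *\<^sub>C g"
  have sG: "star G = - G"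
  proof -
    have "star G + G = (cnj \<i> + \<i>) *\<^sub>C g"
      using g by (simp only: G_def star_scaleC selfadjoint_def scaleC_add_left)
    then show ?thesis by (simp add: eq_neg_iff_add_eq_0)
  qed
  have GG: "G * G = - (g * g)"
  proof -
    have "G * G = (-1) *\<^sub>R (g * g)"
      unfolding scaleR_scaleC G_def by (simp add: mult_scaleC_left mult_scaleC_right scaleC_scaleC)
    then show ?thesis by simp
  qed
  have "alg_invertible ((- \<i>) *\<^sub>C (\<i> *\<^sub>C 1 - g))"
    using alg_invertible_nonreal[OF g, of \<i>] by (simp add: alg_invertible_scaleC_iff)
  moreover have "(- \<i>) *\<^sub>C (\<i> *\<^sub>C 1 - g) = 1 + G"
  proof -
    have "(- \<i>) *\<^sub>C (\<i> *\<^sub>C 1 - g) + (- \<i>) *\<^sub>C g = (1::'a)"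
      by (simp only: scaleC_add_right[symmetric] diff_add_cancel scaleC_scaleC)
        (simp add: scaleC_one)
    moreover have "(- \<i>) *\<^sub>C g + G = 0"
      by (simp add: G_def flip: scaleC_add_left)
    ultimately show ?thesis by (metis add.assoc add.right_neutral)
  qed
  ultimately obtain y where y: "(1 + G) * y = 1" "y * (1 + G) = 1"
    by (auto simp: alg_invertible_def)
  define y' where "y' = star y"
  have y': "y' * (1 - G) = 1" "(1 - G) * y' = 1"
    using arg_cong[OF y(1), of star] arg_cong[OF y(2), of star]
    by (simp_all add: star_mult star_add sG y'_def)
  have p: "(1 - G) * (1 + G) = 1 + g * g" "(1 + G) * (1 - G) = 1 + g * g"
    by (simp_all add: algebra_simps GG)
  define w where "w = y' * y"
  have w1: "(1 + g * g) * w = 1"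
  proof -
    have "(1 + g * g) * w = (1 + G) * ((1 - G) * y') * y" by (simp only: p(2)[symmetric] w_def mult.assoc)
    then show ?thesis by (simp add: y y')
  qed
  have w2: "w * (1 + g * g) = 1"
  proof -
    have "w * (1 + g * g) = y' * (y * (1 + G)) * (1 - G)" by (simp only: p(2)[symmetric] w_def mult.assoc)
    then show ?thesis by (simp add: y y')
  qed
  have yy': "y * y' = w"
  proof -
    have "(y * y') * (1 + g * g) = y * (y' * (1 - G)) * (1 + G)"
      by (simp only: p(1)[symmetric] mult.assoc)
    then have "(y * y') * (1 + g * g) = 1" by (simp add: y y')
    then have "w = (y * y') * ((1 + g * g) * w)" by (simp only: mult.assoc[symmetric] mult_1_left)
    then show ?thesis by (simp add: w1)
  qed
  have sum: "y + y' = 2 *\<^sub>R w"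
  proof -
    have "y + y' = y' * (1 - G) * y + y' * ((1 + G) * y)" by (simp add: y y')
    also have "\<dots> = 2 *\<^sub>R w" by (simp add: w_def algebra_simps scaleR_2)
    finally show ?thesis .
  qed
  define u where "u = 2 *\<^sub>R y - 1"
  have su: "star u = 2 *\<^sub>R y' - 1"
    by (simp add: u_def star_diff star_scaleR y'_def)
  have uu: "star u * u = 1" "u * star u = 1"
  proof -
    have "star u * u = 4 *\<^sub>R w - 2 *\<^sub>R (y + y') + 1"
      unfolding su unfolding u_def w_def by (simp add: algebra_simps)
    then show "star u * u = 1" by (simp add: sum)
    have "u * star u = 4 *\<^sub>R w - 2 *\<^sub>R (y + y') + 1"
      unfolding su unfolding u_def yy'[symmetric] by (simp add: algebra_simps)
    then show "u * star u = 1" by (simp add: sum)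
  qed
  have nu: "norm u \<le> 1"
    using cstar_identity[of u] norm_one_le[where 'a='a] uu by (simp add: abs_square_le_1)
  have usum: "u + star u = 4 *\<^sub>R w - 2 *\<^sub>R 1"
    using arg_cong[OF sum, of "\<lambda>x. 2 *\<^sub>R x"] unfolding su unfolding u_def
    by (simp add: algebra_simps flip: scaleR_2)
  have "16 *\<^sub>R (w - w * w) = 4 *\<^sub>R 1 - (u + star u) * (u + star u)"
    unfolding usum by (simp add: algebra_simps flip: scaleR_add_left)
  also have "\<dots> = 2 *\<^sub>R 1 - u * u - star u * star u"
    using uu by (simp add: algebra_simps scaleR_add_left[of 2 2, simplified]) (simp add: scaleR_2)
  finally have "norm (16 *\<^sub>R (w - w * w)) \<le> norm (2 *\<^sub>R (1::'a)) + norm (u * u) + norm (star u * star u)"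
    using norm_triangle_ineq4 by (metis (no_types, lifting) add_right_mono order_trans)
  also have "\<dots> \<le> 2 + 1 + 1"
    using norm_mult_ineq[of u u] norm_mult_ineq[of "star u" "star u"] mult_mono[OF nu nu]
      norm_one_le[where 'a='a] by (intro add_mono) (simp_all add: norm_star)
  finally have ww: "norm (w - w * w) \<le> 1/4" by simp
  have "star w = w" by (simp add: w_def star_mult y'_def star_star)
  then have sa: "selfadjoint (1 - w)" by (simp add: selfadjoint_def star_diff)
  have c: "1 - w = g * g * w" using w1 by (simp add: algebra_simps eq_diff_eq)
  have "(1 - w) * (1 - w) = g * g * (w - w * w)"
    using c by (metis mult.assoc mult_1_right right_diff_distrib)
  then have "(norm (1 - w))\<^sup>2 \<le> norm (g * g) * norm (w - w * w)"
    using norm_selfadjoint_square[OF sa] norm_mult_ineq by metis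
  also have "\<dots> \<le> 1 * (1/4)"
    using norm_mult_ineq[of g g] mult_mono[OF le le] ww by (intro mult_mono) simp_all
  finally have "(norm (1 - w))\<^sup>2 \<le> (1/2)\<^sup>2" by (simp add: power2_eq_square)
  then have "norm (1 - w) \<le> 1/2" by (rule power2_le_imp_le) simp
  with w1 w2 show ?thesis using that by blast
qed

text \<open>
  Suppose \<open>1 - h\<^sup>2\<close> is invertible, and square repeatedly.  If \<open>k = g\<^sup>2\<close> is one of the
  resulting powers of \<open>h\<close>, inverses \<open>v\<close> of \<open>1 - k\<close> and \<open>w\<close> of \<open>1 + k\<close> give the inverse
  \<open>w v\<close> of \<open>1 - k\<^sup>2\<close>, and \<open>w v - 1 = (1 - w) (v - 1)\<close> has at most half the norm of
  \<open>v - 1\<close>.  So the inverses tend to \<open>1\<close>, hence the powers tend to \<open>0\<close>; but they have norm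
  \<open>1\<close> by the C*-identity.
\<close>

lemma not_invertible_one_minus_square:
  assumes h: "selfadjoint (h::'a::unital_cstar_algebra)" and n1: "norm h = 1"
  shows "\<not> alg_invertible (1 - h * h)"
proof
  assume "alg_invertible (1 - h * h)"
  then obtain v0 where v0: "(1 - h * h) * v0 = 1" "v0 * (1 - h * h) = 1"
    by (auto simp: alg_invertible_def)
  define g where "g m = h ^ (2 ^ m)" for m
  have gS: "g (Suc m) = g m * g m" for m
    by (simp add: g_def mult_2 power_add)
  have sg: "selfadjoint (g m)" for m using h by (simp add: g_def)
  have ng: "norm (g m) = 1" for m
  proof (induction m)
    case 0 show ?case by (simp add: g_def n1)
  next
    case (Suc m) then show ?case by (simp add: gS norm_selfadjoint_square[OF sg])
  qed
  have ex: "\<exists>v. (1 - g m * g m) * v = 1 \<and> v * (1 - g m * g m) = 1 \<and>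
      norm (v - 1) \<le> norm (v0 - 1) * (1/2) ^ m" for m
  proof (induction m)
    case 0 show ?case using v0 by (intro exI[of _ v0]) (simp add: g_def)
  next
    case (Suc m)
    define k where "k = g m * g m"
    obtain v where v: "(1 - k) * v = 1" "v * (1 - k) = 1"
      "norm (v - 1) \<le> norm (v0 - 1) * (1/2) ^ m" using Suc by (auto simp: k_def)
    obtain w where w: "w * (1 + k) = 1" "(1 + k) * w = 1" "norm (1 - w) \<le> 1/2"
      using inverse_one_plus_square[OF sg, of m] ng k_def by (metis order_refl)
    have kk: "1 - k * k = (1 - k) * (1 + k)" "1 - k * k = (1 + k) * (1 - k)"
      by (simp_all add: algebra_simps)
    have i1: "(1 - k * k) * (w * v) = (1 - k) * ((1 + k) * w) * v"
      by (simp only: kk(1) mult.assoc)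
    have i2: "(w * v) * (1 - k * k) = w * (v * (1 - k)) * (1 + k)"
      by (simp only: kk(1) mult.assoc)
    have "v + w = w * (1 + k) * v + w * ((1 - k) * v)" by (simp add: v w)
    also have "\<dots> = w * v + w * v" by (simp add: algebra_simps)
    finally have "w * v - 1 = (1 - w) * (v - 1)" by (simp add: algebra_simps)
    then have "norm (w * v - 1) \<le> norm (1 - w) * norm (v - 1)"
      by (simp add: norm_mult_ineq)
    also have "\<dots> \<le> 1/2 * (norm (v0 - 1) * (1/2) ^ m)"
      using v w by (intro mult_mono) simp_all
    finally have "norm (w * v - 1) \<le> norm (v0 - 1) * (1/2) ^ Suc m" by simp
    then show ?case using i1 i2 v w by (intro exI[of _ "w * v"]) (simp add: gS k_def)
  qed
  obtain m where m: "(1/2) ^ m < 1 / (2 * (norm (v0 - 1) + 1))"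
    using real_arch_pow_inv[of "1 / (2 * (norm (v0 - 1) + 1))" "1/2"]
    by (auto simp: add_nonneg_pos)
  obtain v where v: "(1 - g m * g m) * v = 1" "norm (v - 1) \<le> norm (v0 - 1) * (1/2) ^ m"
    using ex[of m] by auto
  define k where "k = g m * g m"
  have nk: "norm k = 1" using ng[of "Suc m"] by (simp add: k_def gS)
  have "k = (v - 1) - k * (v - 1)" using v(1) by (simp add: algebra_simps flip: k_def)
  then have "norm k \<le> norm (v - 1) + norm k * norm (v - 1)"
    using norm_triangle_ineq4[of "v - 1" "k * (v - 1)"] norm_mult_ineq[of k "v - 1"] by simp
  then have "1 \<le> 2 * norm (v - 1)" by (simp add: nk)
  also have "\<dots> \<le> 2 * ((norm (v0 - 1) + 1) * (1/2) ^ m)"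
    using v(2) by (simp add: algebra_simps)
      (smt (verit) zero_le_power divide_nonneg_nonneg)
  also have "\<dots> < 1"
    using m by (subst (asm) pos_less_divide_eq) (auto simp: algebra_simps intro!: add_pos_nonneg)
  finally show False by simp
qed

lemma norm_in_spectrum:
  assumes x: "selfadjoint (x::'a::unital_cstar_algebra)" and "norm x \<noteq> 0"
  shows "\<not> (alg_invertible (norm x *\<^sub>R 1 - x) \<and> alg_invertible (norm x *\<^sub>R 1 + x))"
proof
  assume *: "alg_invertible (norm x *\<^sub>R 1 - x) \<and> alg_invertible (norm x *\<^sub>R 1 + x)"
  define h where "h = inverse (norm x) *\<^sub>R x"
  have "norm x *\<^sub>R 1 - x = norm x *\<^sub>R (1 - h)" "norm x *\<^sub>R 1 + x = norm x *\<^sub>R (1 + h)"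
    using assms(2) by (simp_all add: h_def scaleR_diff_right scaleR_add_right)
  then have "alg_invertible ((1 - h) * (1 + h))"
    using * assms(2) by (intro alg_invertible_mult) (metis alg_invertible_scaleR_iff)+
  moreover have "(1 - h) * (1 + h) = 1 - h * h" by (simp add: algebra_simps)
  moreover have "selfadjoint h" "norm h = 1" using assms by (simp_all add: h_def)
  ultimately show False using not_invertible_one_minus_square[of h] by simp
qed

section \<open>The positive cone\<close>

lemma positive_elem_iff_invertible:
  "positive_elem h \<longleftrightarrow>
     selfadjoint (h::'a::unital_cstar_algebra) \<and> (\<forall>t>0. alg_invertible (t *\<^sub>R 1 + h))"
proof (intro iffI conjI allI impI)
  assume p: "positive_elem h"
  then show "selfadjoint h" by (simp add: positive_elem_def)
  fix t :: real assume "t > 0"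
  then have "complex_of_real (- t) \<notin> alg_spectrum h"
    using p unfolding positive_elem_def by fastforce
  then have "alg_invertible ((- t) *\<^sub>R 1 - h)" unfolding alg_spectrum_def by (simp add: scaleR_scaleC)
  then show "alg_invertible (t *\<^sub>R 1 + h)"
    using alg_invertible_diff_commute[of "(- t) *\<^sub>R 1" h] by (simp add: add.commute)
next
  assume *: "selfadjoint h \<and> (\<forall>t>0. alg_invertible (t *\<^sub>R 1 + h))"
  show "positive_elem h" unfolding positive_elem_def
  proof (intro conjI subsetI)
    fix z assume z: "z \<in> alg_spectrum h"
    then have "Im z = 0" using * alg_invertible_nonreal[of h z] by (auto simp: alg_spectrum_def)
    then have zr: "z = complex_of_real (Re z)" by (simp add: complex_eq_iff)
    have "\<not> alg_invertible (Re z *\<^sub>R 1 - h)"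
      using z zr by (simp add: alg_spectrum_def scaleR_scaleC)
    then have "\<not> alg_invertible ((- Re z) *\<^sub>R 1 + h)"
      using alg_invertible_diff_commute[of "Re z *\<^sub>R 1" h] by simp
    then have "0 \<le> Re z" using * by (meson not_less neg_0_less_iff_less)
    then show "z \<in> complex_of_real ` {0..}" using zr by (metis atLeast_iff imageI)
  qed (use * in auto)
qed

lemma positive_elem_selfadjoint: "positive_elem h \<Longrightarrow> selfadjoint h"
  by (simp add: positive_elem_def)

text \<open>
  The norm description of positivity makes the cone visibly convex and closed.
\<close>

lemma positive_elem_if_norm_le:
  assumes "selfadjoint (h::'a::unital_cstar_algebra)" "norm (r *\<^sub>R 1 - h) \<le> r"
  shows "positive_elem h"
  unfolding positive_elem_iff_invertible
proof (intro conjI allI impI)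
  fix t :: real assume "t > 0"
  with assms(2) have "alg_invertible ((t + r) *\<^sub>R 1 - (r *\<^sub>R 1 - h))"
    by (intro alg_invertible_real_if_norm_less) linarith
  then show "alg_invertible (t *\<^sub>R 1 + h)" by (simp add: algebra_simps)
qed fact

text \<open>
  If \<open>x = r - h\<close> had norm \<open>s > r\<close>, then \<open>s\<close> or \<open>- s\<close> would be a spectral value of
  \<open>x\<close>, so \<open>r - s < 0\<close> or \<open>r + s > norm h\<close> one of \<open>h\<close>.
\<close>

lemma norm_le_if_positive_elem:
  assumes p: "positive_elem (h::'a::unital_cstar_algebra)" and r: "norm h \<le> r"
  shows "norm (r *\<^sub>R 1 - h) \<le> r"
proof (rule ccontr)
  define x where "x = r *\<^sub>R 1 - h"
  assume "\<not> norm (r *\<^sub>R 1 - h) \<le> r"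
  then have s: "norm x > r" by (simp add: x_def)
  have sa: "selfadjoint x" using p by (simp add: x_def positive_elem_selfadjoint)
  have r0: "0 \<le> r" using r norm_ge_zero order_trans by blast
  have "alg_invertible ((norm x - r) *\<^sub>R 1 + h)"
    using p s by (simp add: positive_elem_iff_invertible)
  moreover have "alg_invertible ((norm x + r) *\<^sub>R 1 - h)"
    using s r r0 by (intro alg_invertible_real_if_norm_less) linarith
  moreover have "(norm x - r) *\<^sub>R 1 + h = norm x *\<^sub>R 1 - x" "(norm x + r) *\<^sub>R 1 - h = norm x *\<^sub>R 1 + x"
    by (simp_all add: x_def scaleR_add_left scaleR_diff_left)
  ultimately show False
    using norm_in_spectrum[OF sa] s r0 by (metis less_le_trans less_irrefl)
qed

lemma positive_elem_add:
  assumes "positive_elem h" "positive_elem (k::'a::unital_cstar_algebra)"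
  shows "positive_elem (h + k)"
proof (rule positive_elem_if_norm_le)
  have "(norm h + norm k) *\<^sub>R 1 - (h + k) = (norm h *\<^sub>R 1 - h) + (norm k *\<^sub>R 1 - k)"
    by (simp add: algebra_simps)
  then show "norm ((norm h + norm k) *\<^sub>R 1 - (h + k)) \<le> norm h + norm k"
    using norm_le_if_positive_elem[OF assms(1)] norm_le_if_positive_elem[OF assms(2)]
    by (metis add_mono norm_triangle_le order_refl)
qed (use assms in \<open>simp add: positive_elem_selfadjoint\<close>)

lemma positive_elem_scaleR:
  assumes "positive_elem (h::'a::unital_cstar_algebra)" "0 \<le> c"
  shows "positive_elem (c *\<^sub>R h)"
proof (rule positive_elem_if_norm_le)
  have "(c * norm h) *\<^sub>R 1 - c *\<^sub>R h = c *\<^sub>R (norm h *\<^sub>R 1 - h)"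
    by (simp add: algebra_simps)
  then show "norm ((c * norm h) *\<^sub>R 1 - c *\<^sub>R h) \<le> c * norm h"
    using norm_le_if_positive_elem[OF assms(1)] assms(2) by (simp add: mult_left_mono)
qed (use assms in \<open>simp add: positive_elem_selfadjoint\<close>)

lemma positive_elem_zero [simp]: "positive_elem (0::'a::unital_cstar_algebra)"
  by (rule positive_elem_if_norm_le[of _ 0]) simp_all

lemma positive_elem_one [simp]: "positive_elem (1::'a::unital_cstar_algebra)"
  by (rule positive_elem_if_norm_le[of _ 1]) simp_all

lemma positive_elem_sum:
  "(\<And>i. i \<in> S \<Longrightarrow> positive_elem (f i :: 'a::unital_cstar_algebra)) \<Longrightarrow> positive_elem (sum f S)"
  by (induction S rule: infinite_finite_induct) (simp_all add: positive_elem_add)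

lemma positive_elem_limit:
  assumes lim: "f \<longlonglongrightarrow> l" and p: "\<And>n. positive_elem (f n :: 'a::unital_cstar_algebra)"
  shows "positive_elem l"
proof (rule positive_elem_if_norm_le)
  have "star (f n) = f n" for n
    using p positive_elem_selfadjoint selfadjoint_def by blast
  then show "selfadjoint l"
    using tendsto_star[OF lim] lim LIMSEQ_unique by (simp add: selfadjoint_def) blast
  have "(\<lambda>n. norm (f n)) \<longlonglongrightarrow> norm l" using lim by (rule tendsto_norm)
  then have "\<forall>\<^sub>F n in sequentially. norm (f n) < norm l + 1"
    by (rule order_tendstoD) simp
  then have ev: "\<forall>\<^sub>F n in sequentially. norm ((norm l + 1) *\<^sub>R 1 - f n) \<le> norm l + 1"
    by eventually_elim (use p norm_le_if_positive_elem less_imp_le in blast)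
  show "norm ((norm l + 1) *\<^sub>R 1 - l) \<le> norm l + 1"
    by (rule tendsto_upperbound[OF _ ev]) (auto intro!: tendsto_intros lim)
qed

lemma positive_elem_limit_scaleR:
  assumes "\<And>n. positive_elem (x + (1 / real (Suc n)) *\<^sub>R (y::'a::unital_cstar_algebra))"
  shows "positive_elem x"
proof -
  have "(\<lambda>n. x + (1 / real (Suc n)) *\<^sub>R y) \<longlonglongrightarrow> x + 0 *\<^sub>R y"
    using LIMSEQ_inverse_real_of_nat by (intro tendsto_intros) (simp add: inverse_eq_divide)
  then show ?thesis using positive_elem_limit assms by simp blast
qed

lemma positive_elem_antisym:
  assumes "positive_elem x" "positive_elem (- x::'a::unital_cstar_algebra)"
  shows "x = 0"
proof (rule ccontr)
  assume "x \<noteq> 0"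
  then have n: "norm x > 0" by simp
  have "alg_invertible (norm x *\<^sub>R 1 + x)" "alg_invertible (norm x *\<^sub>R 1 - x)"
    using assms n unfolding positive_elem_iff_invertible by (metis, metis uminus_add_conv_diff add.commute)
  then show False using norm_in_spectrum[of x] n assms(1) positive_elem_selfadjoint by auto
qed

lemma positive_elem_square:
  assumes h: "selfadjoint (h::'a::unital_cstar_algebra)"
  shows "positive_elem (h * h)"
  unfolding positive_elem_iff_invertible
proof (intro conjI allI impI)
  show "selfadjoint (h * h)" using h by simp
  fix t :: real assume t: "t > 0"
  \<comment> \<open>\<open>t + h\<^sup>2\<close> splits into the factors \<open>\<plusminus> w - h\<close> with \<open>w\<close> purely imaginary.\<close>
  define w where "w = \<i> * of_real (sqrt t)"
  have "alg_invertible ((w *\<^sub>C 1 - h) * ((- w) *\<^sub>C 1 - h))"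
    using t by (intro alg_invertible_mult alg_invertible_nonreal[OF h]) (simp_all add: w_def)
  moreover have "(w *\<^sub>C 1 - h) * ((- w) *\<^sub>C 1 - h) = (w * (- w)) *\<^sub>C 1 - (w + (- w)) *\<^sub>C h + h * h"
    unfolding scaleC_add_left
    by (simp add: algebra_simps mult_scaleC_left mult_scaleC_right scaleC_scaleC
        scaleC_minus_left scaleC_diff_right)
  moreover have "w * (- w) = of_real t"
    using t by (simp add: w_def algebra_simps flip: of_real_mult)
  ultimately show "alg_invertible (t *\<^sub>R 1 + h * h)" by (simp add: scaleR_scaleC)
qed

text \<open>
  Write \<open>m - \<delta> + t = (1 - (\<delta> - t) n) m\<close> for \<open>t > 0\<close>.  The first factor is invertible by
  positivity of \<open>n\<close> if \<open>\<delta> < t\<close>, and by the Neumann series otherwise, as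
  \<open>\<delta> norm n < 1\<close>.
\<close>

lemma positive_elem_inverse_bounded_below:
  assumes n: "positive_elem (n::'a::unital_cstar_algebra)" and m: "n * m = 1" "m * n = 1"
  obtains \<delta> where "\<delta> > 0" "positive_elem (m - \<delta> *\<^sub>R 1)"
proof -
  define \<delta> where "\<delta> = 1 / (norm n + 1)"
  have \<delta>: "\<delta> > 0" by (simp add: \<delta>_def add_nonneg_pos)
  have "star n = n" using n positive_elem_selfadjoint selfadjoint_def by blast
  then have "star m * n = 1" using arg_cong[OF m(1), of star] by (simp add: star_mult)
  then have "star m = m" using m(1) by (metis mult.assoc mult_1_left mult_1_right)
  then have sm: "selfadjoint m" by (simp add: selfadjoint_def)
  have im: "alg_invertible m" using m by (auto simp: alg_invertible_def)
  have "positive_elem (m - \<delta> *\<^sub>R 1)"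
    unfolding positive_elem_iff_invertible
  proof (intro conjI allI impI)
    fix t :: real assume t: "t > 0"
    define a where "a = \<delta> - t"
    have "alg_invertible (1 - a *\<^sub>R n)"
    proof (cases "a < 0")
      case True
      have "alg_invertible ((1 / (- a)) *\<^sub>R 1 + n)"
        using n True by (metis positive_elem_iff_invertible neg_0_less_iff_less zero_less_divide_1_iff)
      then have "alg_invertible ((- a) *\<^sub>R ((1 / (- a)) *\<^sub>R 1 + n))"
        using True by (subst alg_invertible_scaleR_iff) simp_all
      moreover have "(- a) *\<^sub>R ((1 / (- a)) *\<^sub>R 1 + n) = 1 - a *\<^sub>R n"
        using True by (simp add: scaleR_diff_right)
      ultimately show ?thesis by simp
    next
      case False
      have "a * norm n \<le> \<delta> * norm n" using t by (intro mult_right_mono) (simp_all add: a_def)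
      also have "\<dots> < 1" by (simp add: \<delta>_def add_nonneg_pos)
      finally show ?thesis using False by (intro alg_invertible_one_minus) simp
    qed
    then have "alg_invertible ((1 - a *\<^sub>R n) * m)" using im by (rule alg_invertible_mult)
    then show "alg_invertible (t *\<^sub>R 1 + (m - \<delta> *\<^sub>R 1))"
      by (simp add: left_diff_distrib m a_def algebra_simps)
  qed (use sm in simp)
  with \<delta> show ?thesis using that by blast
qed

text \<open>Jacobson's lemma: \<open>x y\<close> and \<open>y x\<close> have the same spectrum away from \<open>0\<close>.\<close>

lemma alg_invertible_add_mult_commute:
  assumes "alg_invertible (t *\<^sub>R 1 + x * y)" "t \<noteq> 0"
  shows "alg_invertible (t *\<^sub>R 1 + y * (x::'a::unital_cstar_algebra))"
proof -
  obtain v where v: "(t *\<^sub>R 1 + x * y) * v = 1" "v * (t *\<^sub>R 1 + x * y) = 1"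
    using assms by (auto simp: alg_invertible_def)
  have v': "x * y * v = 1 - t *\<^sub>R v" "v * x * y = 1 - t *\<^sub>R v"
    using v by (simp_all add: algebra_simps eq_diff_eq)
  have "(t *\<^sub>R 1 + y * x) * (1 - y * v * x) = t *\<^sub>R 1 + y * x - t *\<^sub>R (y * v * x) - y * (x * y * v) * x"
    by (simp add: algebra_simps)
  also have "\<dots> = t *\<^sub>R 1" unfolding v' by (simp add: algebra_simps)
  finally have 1: "(t *\<^sub>R 1 + y * x) * (1 - y * v * x) = t *\<^sub>R 1" .
  have "(1 - y * v * x) * (t *\<^sub>R 1 + y * x) = t *\<^sub>R 1 + y * x - t *\<^sub>R (y * v * x) - y * (v * x * y) * x"
    by (simp add: algebra_simps)
  also have "\<dots> = t *\<^sub>R 1" unfolding v' by (simp add: algebra_simps)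
  finally have 2: "(1 - y * v * x) * (t *\<^sub>R 1 + y * x) = t *\<^sub>R 1" .
  show ?thesis unfolding alg_invertible_def using 1 2 assms(2)
    by (intro exI[of _ "inverse t *\<^sub>R (1 - y * v * x)"]) simp
qed

text \<open>
  For invertible \<open>e\<close>, the spectrum of \<open>f e f\<close> away from \<open>0\<close> is that of
  \<open>e f\<^sup>2\<close>, and \<open>e f\<^sup>2 + t = e (f\<^sup>2 + t e\<^sup>-\<^sup>1)\<close> is invertible because the second
  factor is a positive element plus a positive multiple of the unit.
\<close>

lemma positive_elem_conj:
  assumes e: "positive_elem e" and f: "selfadjoint (f::'a::unital_cstar_algebra)"
  shows "positive_elem (f * e * f)"
proof -
  have inv: "positive_elem (f * n * f)" if n: "positive_elem n" "alg_invertible n" for n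
    unfolding positive_elem_iff_invertible
  proof (intro conjI allI impI)
    show "selfadjoint (f * n * f)" using n f by (simp add: positive_elem_selfadjoint)
    fix t :: real assume t: "t > 0"
    obtain m where m: "n * m = 1" "m * n = 1" using n(2) by (auto simp: alg_invertible_def)
    obtain \<delta> where \<delta>: "\<delta> > 0" "positive_elem (m - \<delta> *\<^sub>R 1)"
      using positive_elem_inverse_bounded_below[OF n(1) m] .
    have "positive_elem (t *\<^sub>R (m - \<delta> *\<^sub>R 1) + f * f)"
      using t \<delta> f by (intro positive_elem_add positive_elem_scaleR positive_elem_square) simp_all
    then have "alg_invertible ((t * \<delta>) *\<^sub>R 1 + (t *\<^sub>R (m - \<delta> *\<^sub>R 1) + f * f))"
      using t \<delta> unfolding positive_elem_iff_invertible by (metis mult_pos_pos)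
    then have "alg_invertible (n * (t *\<^sub>R m + f * f))"
      using n(2) by (intro alg_invertible_mult) (simp_all add: algebra_simps)
    then have "alg_invertible (t *\<^sub>R 1 + (n * f) * f)" by (simp add: algebra_simps m)
    then show "alg_invertible (t *\<^sub>R 1 + f * n * f)"
      using alg_invertible_add_mult_commute[of t "n * f" f] t by (simp add: mult.assoc)
  qed
  show ?thesis
  proof (rule positive_elem_limit_scaleR[of _ "f * f"])
    fix n :: nat
    define \<epsilon> where "\<epsilon> = 1 / real (Suc n)"
    have "\<epsilon> > 0" by (simp add: \<epsilon>_def)
    then have "positive_elem (\<epsilon> *\<^sub>R 1 + e)" "alg_invertible (\<epsilon> *\<^sub>R 1 + e)"
      using e by (simp add: positive_elem_add positive_elem_scaleR,
          simp add: positive_elem_iff_invertible)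
    from inv[OF this] show "positive_elem (f * e * f + (1 / real (Suc n)) *\<^sub>R (f * f))"
      unfolding \<epsilon>_def[symmetric] by (simp add: algebra_simps)
  qed
qed

text \<open>
  The difference of the two sides is half of the sum of all \<open>(f i - f j) X (f i - f j)\<close>.
\<close>

lemma positive_elem_pinching:
  fixes X :: "'a::unital_cstar_algebra" and f :: "nat \<Rightarrow> 'a"
  assumes X: "positive_elem X" and f: "\<And>i. selfadjoint (f i)" and sum1: "(\<Sum>i<m. f i) = 1"
  shows "positive_elem (real m *\<^sub>R (\<Sum>i<m. f i * X * f i) - X)"
proof -
  define T where "T = (\<Sum>i<m. f i * X * f i)"
  have p: "positive_elem ((1/2) *\<^sub>R (\<Sum>i<m. \<Sum>j<m. (f i - f j) * X * (f i - f j)))"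
    by (intro positive_elem_scaleR positive_elem_sum positive_elem_conj X selfadjoint_intros f) simp
  have expand: "(\<Sum>i<m. \<Sum>j<m. (f i - f j) * X * (f i - f j)) =
      (\<Sum>i<m. \<Sum>j<m. f i * X * f i) + (\<Sum>i<m. \<Sum>j<m. f j * X * f j)
      - (\<Sum>i<m. \<Sum>j<m. f i * X * f j) - (\<Sum>i<m. \<Sum>j<m. f j * X * f i)"
    by (simp add: sum.distrib sum_subtractf algebra_simps)
  have diag: "(\<Sum>i<m. \<Sum>j<m. f i * X * f i) = real m *\<^sub>R T" "(\<Sum>i<m. \<Sum>j<m. f j * X * f j) = real m *\<^sub>R T"
    by (simp_all add: T_def sum_constant_scaleR scaleR_sum_right)
  have off: "(\<Sum>i<m. \<Sum>j<m. f i * X * f j) = X" "(\<Sum>i<m. \<Sum>j<m. f j * X * f i) = X"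
    by (simp_all add: sum1 flip: sum_distrib_left sum_distrib_right)
  have "(\<Sum>i<m. \<Sum>j<m. (f i - f j) * X * (f i - f j)) = 2 *\<^sub>R (real m *\<^sub>R T - X)"
    unfolding expand diag off scaleR_2 by (simp add: algebra_simps)
  with p show ?thesis by (simp add: T_def)
qed

section \<open>Polynomials in one element\<close>

definition cpoly_eval :: "complex poly \<Rightarrow> 'a::unital_cstar_algebra \<Rightarrow> 'a" where
  "cpoly_eval p x = fold_coeffs (\<lambda>c y. c *\<^sub>C 1 + x * y) p 0"

lemma cpoly_eval_0 [simp]: "cpoly_eval 0 x = 0"
  by (simp add: cpoly_eval_def)

lemma cpoly_eval_pCons [simp]: "cpoly_eval (pCons c p) x = c *\<^sub>C 1 + x * cpoly_eval p x"
  by (cases "p = 0 \<and> c = 0") (auto simp: cpoly_eval_def)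

lemma cpoly_eval_1 [simp]: "cpoly_eval 1 x = 1"
  by (simp add: one_pCons scaleC_one)

lemma cpoly_eval_add: "cpoly_eval (p + q) x = cpoly_eval p x + cpoly_eval q x"
  by (induction p q rule: poly_induct2) (simp_all add: scaleC_add_left algebra_simps)

lemma cpoly_eval_smult: "cpoly_eval (smult c p) x = c *\<^sub>C cpoly_eval p x"
  by (induction p) (simp_all add: scaleC_add_right scaleC_scaleC mult_scaleC_right)

lemma cpoly_eval_mult: "cpoly_eval (p * q) x = cpoly_eval p x * cpoly_eval q x"
  by (induction p)
    (simp_all add: cpoly_eval_add cpoly_eval_smult distrib_right mult_scaleC_left mult.assoc)

lemma alg_invertible_cpoly_eval:
  assumes "p \<noteq> 0" "\<And>z. poly p z = 0 \<Longrightarrow> alg_invertible (z *\<^sub>C 1 - x)"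
  shows "alg_invertible (cpoly_eval p x)"
  using assms
proof (induction "degree p" arbitrary: p)
  case 0
  then obtain c where "p = [:c:]" by (metis degree_eq_zeroE)
  with 0 show ?case by (simp add: alg_invertible_scaleC_iff)
next
  case (Suc n)
  then have "\<not> constant (poly p)" by (simp add: constant_degree)
  then obtain z where z: "poly p z = 0" using fundamental_theorem_of_algebra by blast
  then obtain q where q: "p = [:- z, 1:] * q" by (metis dvd_def poly_eq_0_iff_dvd)
  have q0: "q \<noteq> 0" using Suc.prems q by auto
  then have "degree q = n" using Suc.hyps(2) q degree_mult_eq[of "[:- z, 1:]" q] by simp
  moreover have "alg_invertible (w *\<^sub>C 1 - x)" if "poly q w = 0" for w
    using that Suc.prems(2)[of w] by (simp add: q)
  ultimately have "alg_invertible (cpoly_eval q x)" using Suc.hyps(1) q0 by blast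
  moreover have "cpoly_eval [:- z, 1:] x = x - z *\<^sub>C 1"
    by (simp add: scaleC_minus_left scaleC_one)
  then have "alg_invertible (cpoly_eval [:- z, 1:] x)"
    using Suc.prems(2)[OF z] by (simp add: alg_invertible_diff_commute)
  ultimately show ?case unfolding q cpoly_eval_mult by (intro alg_invertible_mult)
qed

definition rpoly_eval :: "real poly \<Rightarrow> 'a::unital_cstar_algebra \<Rightarrow> 'a" where
  "rpoly_eval p = cpoly_eval (map_poly of_real p)"

lemma rpoly_eval_0 [simp]: "rpoly_eval 0 x = 0"
  by (simp add: rpoly_eval_def)

lemma rpoly_eval_pCons [simp]: "rpoly_eval (pCons c p) x = c *\<^sub>R 1 + x * rpoly_eval p x"
  by (simp add: rpoly_eval_def map_poly_pCons scaleR_scaleC)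

lemma rpoly_eval_1 [simp]: "rpoly_eval 1 x = 1"
  by (simp add: one_pCons)

lemma rpoly_eval_add: "rpoly_eval (p + q) x = rpoly_eval p x + rpoly_eval q x"
  by (induction p q rule: poly_induct2) (simp_all add: scaleR_add_left algebra_simps)

lemma rpoly_eval_smult: "rpoly_eval (smult c p) x = c *\<^sub>R rpoly_eval p x"
  by (induction p) (simp_all add: scaleR_add_right)

lemma rpoly_eval_diff: "rpoly_eval (p - q) x = rpoly_eval p x - rpoly_eval q x"
  using rpoly_eval_add[of p "smult (-1) q" x] rpoly_eval_smult[of "-1" q x] by simp

lemma rpoly_eval_mult: "rpoly_eval (p * q) x = rpoly_eval p x * rpoly_eval q x"
  by (induction p)
    (simp_all add: rpoly_eval_add rpoly_eval_smult distrib_right mult.assoc)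

lemma rpoly_eval_power: "rpoly_eval (p ^ n) x = rpoly_eval p x ^ n"
  by (induction n) (simp_all add: rpoly_eval_mult)

lemma rpoly_eval_sum: "rpoly_eval (sum f S) x = (\<Sum>i\<in>S. rpoly_eval (f i) x)"
  by (induction S rule: infinite_finite_induct) (simp_all add: rpoly_eval_add)

lemma rpoly_eval_commute: "x * rpoly_eval p x = rpoly_eval p x * x"
  using rpoly_eval_mult[of "[:0, 1:]" p x] rpoly_eval_mult[of p "[:0, 1:]" x]
  by (simp add: mult.commute)

lemma selfadjoint_rpoly_eval:
  assumes "selfadjoint x"
  shows "selfadjoint (rpoly_eval p x)"
proof (induction p)
  case (pCons c p)
  have "star (x * rpoly_eval p x) = x * rpoly_eval p x"
    using assms pCons by (simp add: star_mult selfadjoint_def rpoly_eval_commute)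
  then show ?case by (simp add: selfadjoint_def star_add star_scaleR)
qed simp

text \<open>
  For \<open>t > 0\<close> the complex roots of \<open>p + t\<close> are nonreal or of modulus greater than \<open>M\<close>,
  so none of them is a spectral value of \<open>h\<close>.
\<close>

lemma positive_elem_rpoly_eval:
  assumes h: "selfadjoint h" "norm h \<le> M" and p: "\<And>t. \<bar>t\<bar> \<le> M \<Longrightarrow> 0 \<le> poly p t"
  shows "positive_elem (rpoly_eval p h)"
  unfolding positive_elem_iff_invertible
proof (intro conjI allI impI selfadjoint_rpoly_eval h(1))
  fix t :: real assume t: "t > 0"
  define r where "r = p + [:t:]"
  have M: "0 \<le> M" using h(2) norm_ge_zero order_trans by blast
  have poly_of_real: "poly (map_poly of_real r) (complex_of_real x) = of_real (poly r x)" for x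
    by (induction r) (simp_all add: map_poly_pCons)
  have "alg_invertible (cpoly_eval (map_poly of_real r) h)"
  proof (rule alg_invertible_cpoly_eval)
    have "poly r 0 > 0" using p[of 0] M t by (simp add: r_def)
    then show "map_poly complex_of_real r \<noteq> 0" using poly_of_real[of 0] by auto
    fix z assume z: "poly (map_poly of_real r) z = (0::complex)"
    show "alg_invertible (z *\<^sub>C 1 - h)"
    proof (cases "Im z = 0")
      case True
      then have zr: "z = complex_of_real (Re z)" by (simp add: complex_eq_iff)
      then have "poly r (Re z) = 0" using z poly_of_real by (metis of_real_eq_0_iff)
      then have "\<not> \<bar>Re z\<bar> \<le> M" using p[of "Re z"] t by (auto simp: r_def)
      then have "norm h < cmod z" using h(2) abs_Re_le_cmod[of z] by linarith
      then show ?thesis by (rule alg_invertible_if_norm_less)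
    qed (use h(1) alg_invertible_nonreal in blast)
  qed
  then show "alg_invertible (t *\<^sub>R 1 + rpoly_eval p h)"
    by (simp add: rpoly_eval_add add.commute r_def flip: rpoly_eval_def)
qed

section \<open>Kadison's inequality\<close>

locale unital_positive_map =
  fixes \<Phi> :: "'a::unital_cstar_algebra \<Rightarrow> 'b::unital_cstar_algebra"
  assumes clinear: "clinear \<Phi>" and unital: "unital_map \<Phi>" and positive: "positive_map \<Phi>"
begin

lemma map_add: "\<Phi> (x + y) = \<Phi> x + \<Phi> y"
  using clinear by (simp add: Vector_Spaces.linear_iff)

lemma map_scaleC: "\<Phi> (z *\<^sub>C x) = z *\<^sub>C \<Phi> x"
  using clinear by (simp add: Vector_Spaces.linear_iff)

lemma map_scaleR: "\<Phi> (r *\<^sub>R x) = r *\<^sub>R \<Phi> x"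
  by (simp add: scaleR_scaleC map_scaleC)

lemma map_zero: "\<Phi> 0 = 0"
  using map_scaleR[of 0 0] by simp

lemma map_diff: "\<Phi> (x - y) = \<Phi> x - \<Phi> y"
  using map_add[of "x - y" y] by simp

lemma map_sum: "\<Phi> (sum f S) = (\<Sum>i\<in>S. \<Phi> (f i))"
  by (induction S rule: infinite_finite_induct) (simp_all add: map_add map_zero)

lemma map_one: "\<Phi> 1 = 1"
  using unital by (simp add: unital_map_def)

lemma map_positive: "positive_elem c \<Longrightarrow> positive_elem (\<Phi> c)"
  using positive by (simp add: positive_map_def)

lemma map_selfadjoint:
  assumes "selfadjoint c"
  shows "selfadjoint (\<Phi> c)"
proof -
  have "positive_elem (norm c *\<^sub>R 1 + c)"
    by (rule positive_elem_if_norm_le[of _ "norm c"]) (use assms in simp_all)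
  then have "selfadjoint (\<Phi> (norm c *\<^sub>R 1 + c))" by (intro positive_elem_selfadjoint map_positive)
  then have "selfadjoint (\<Phi> (norm c *\<^sub>R 1 + c) - norm c *\<^sub>R 1)" by simp
  then show ?thesis by (simp add: map_add map_scaleR map_one)
qed

text \<open>
  If \<open>\<Phi>\<close> were given by finitely many positive elements \<open>F k\<close> with sum \<open>1\<close>, as
  \<open>\<Phi> (f c) = (\<Sum>k. f (y k) F k)\<close>, the element below would be the sum of the positive
  elements \<open>(y k - \<beta>) (F k) (y k - \<beta>)\<close>.  The images of the Bernstein polynomials of
  degree \<open>n\<close> in \<open>c\<close> represent \<open>\<Phi>\<close> in this way on affine functions, and up to
  an error of order \<open>1 / n\<close> on the square.
\<close>

lemma kadison_shifted:
  assumes c: "selfadjoint c" and \<beta>: "selfadjoint \<beta>"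
  shows "positive_elem (\<Phi> (c * c) - \<beta> * \<Phi> c - \<Phi> c * \<beta> + \<beta> * \<beta>)"
proof -
  define M where "M = norm c + 1"
  have M: "M > 0" "norm c \<le> M" by (simp_all add: M_def add_nonneg_pos)
  have pos: "positive_elem (\<Phi> (c * c) - \<beta> * \<Phi> c - \<Phi> c * \<beta> + \<beta> * \<beta>
      + (1 / real n) *\<^sub>R (M\<^sup>2 *\<^sub>R 1 - \<Phi> (c * c)))" if n: "n \<ge> 1" for n
  proof -
    define B where "B k = smult (real (n choose k))
        ([:1/2, 1/(2*M):] ^ k * [:1/2, - 1/(2*M):] ^ (n - k))" for k
    define y where "y k = 2 * M / real n * real k - M" for k
    have polyB: "poly (B k) t = Bernstein n k (1/2 + t/(2*M))" for k t
    proof -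
      have "1/2 - t/(2*M) = 1 - (1/2 + t/(2*M))" by simp
      then show ?thesis by (simp add: B_def Bernstein_def mult.assoc)
    qed
    have B0: "(\<Sum>k\<le>n. B k) = 1"
      by (rule poly_eq_poly_eq_iff[THEN iffD1], rule ext) (simp add: poly_sum polyB)
    have s1: "(\<Sum>k\<le>n. real k * poly (B k) t) = real n * (1/2 + t/(2*M))" for t
      by (simp only: polyB sum_k_Bernstein)
    have "(\<Sum>k\<le>n. real k * real k * poly (B k) t) =
        (\<Sum>k\<le>n. real k * (real k - 1) * poly (B k) t) + (\<Sum>k\<le>n. real k * poly (B k) t)" for t
      by (simp add: algebra_simps flip: sum.distrib)
    then have s2: "(\<Sum>k\<le>n. real k * real k * poly (B k) t) =
        real n * (real n - 1) * (1/2 + t/(2*M))\<^sup>2 + real n * (1/2 + t/(2*M))" for t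
      by (simp only: polyB sum_k_Bernstein sum_kk_Bernstein)
    have s0: "(\<Sum>k\<le>n. poly (B k) t) = 1" for t
      by (simp add: polyB)
    have "(\<Sum>k\<le>n. y k * poly (B k) t) = t" for t
    proof -
      have "(\<Sum>k\<le>n. y k * poly (B k) t) =
          2 * M / real n * (\<Sum>k\<le>n. real k * poly (B k) t) - M * (\<Sum>k\<le>n. poly (B k) t)"
        by (simp add: y_def sum_distrib_left sum_subtractf left_diff_distrib mult.assoc)
      then show ?thesis using M n by (simp add: s0 s1 field_simps)
    qed
    then have B1: "(\<Sum>k\<le>n. smult (y k) (B k)) = [:0, 1:]"
      by (intro poly_eq_poly_eq_iff[THEN iffD1] ext) (simp add: poly_sum)
    have "(\<Sum>k\<le>n. (y k)\<^sup>2 * poly (B k) t) = t\<^sup>2 + (M\<^sup>2 - t\<^sup>2) / real n" for t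
    proof -
      have "(\<Sum>k\<le>n. (y k)\<^sup>2 * poly (B k) t) =
          (2 * M / real n)\<^sup>2 * (\<Sum>k\<le>n. real k * real k * poly (B k) t)
          - 2 * (2 * M / real n) * M * (\<Sum>k\<le>n. real k * poly (B k) t)
          + M\<^sup>2 * (\<Sum>k\<le>n. poly (B k) t)"
        by (simp add: y_def sum_distrib_left sum_subtractf[symmetric] sum.distrib[symmetric])
          (intro sum.cong refl, simp add: power2_eq_square algebra_simps)
      also have "\<dots> = t\<^sup>2 + (M\<^sup>2 - t\<^sup>2) / real n"
      proof -
        define u where "u = 1/2 + t/(2*M)"
        have t: "t = M * (2 * u - 1)" using M by (simp add: u_def field_simps)
        show ?thesis unfolding s0 s1 s2 u_def[symmetric] unfolding t
          using n by (simp add: field_simps power2_eq_square)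
      qed
      finally show ?thesis .
    qed
    then have B2: "(\<Sum>k\<le>n. smult ((y k)\<^sup>2) (B k)) =
        [:0, 1:] * [:0, 1:] + smult (1 / real n) ([:M\<^sup>2:] - [:0, 1:] * [:0, 1:])"
      by (intro poly_eq_poly_eq_iff[THEN iffD1] ext)
        (simp add: poly_sum power2_eq_square divide_inverse algebra_simps)
    define F where "F k = \<Phi> (rpoly_eval (B k) c)" for k
    have F: "positive_elem (F k)" if k: "k \<le> n" for k
      unfolding F_def
    proof (intro map_positive positive_elem_rpoly_eval[OF c M(2)])
      fix t assume "\<bar>t\<bar> \<le> M"
      then show "0 \<le> poly (B k) t" unfolding polyB
        using M by (intro Bernstein_nonneg) (simp_all add: field_simps abs_le_iff)
    qed
    have F0: "(\<Sum>k\<le>n. F k) = 1"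
      by (simp add: F_def map_one B0 flip: map_sum rpoly_eval_sum)
    have F1: "(\<Sum>k\<le>n. y k *\<^sub>R F k) = \<Phi> c"
      by (simp add: F_def B1 flip: map_sum rpoly_eval_sum map_scaleR rpoly_eval_smult)
    have F2: "(\<Sum>k\<le>n. (y k)\<^sup>2 *\<^sub>R F k) = \<Phi> (c * c) + (1 / real n) *\<^sub>R (M\<^sup>2 *\<^sub>R 1 - \<Phi> (c * c))"
      unfolding F_def map_scaleR[symmetric] rpoly_eval_smult[symmetric] map_sum[symmetric]
        rpoly_eval_sum[symmetric] B2
      by (simp only: rpoly_eval_add rpoly_eval_diff rpoly_eval_smult rpoly_eval_mult)
        (simp add: map_add map_diff map_scaleR map_one)
    have "positive_elem (\<Sum>k\<le>n. (y k *\<^sub>R 1 - \<beta>) * F k * (y k *\<^sub>R 1 - \<beta>))"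
      using F \<beta> by (intro positive_elem_sum positive_elem_conj) simp_all
    also have "(\<Sum>k\<le>n. (y k *\<^sub>R 1 - \<beta>) * F k * (y k *\<^sub>R 1 - \<beta>)) =
        (\<Sum>k\<le>n. (y k)\<^sup>2 *\<^sub>R F k - \<beta> * (y k *\<^sub>R F k) - (y k *\<^sub>R F k) * \<beta> + \<beta> * F k * \<beta>)"
      by (intro sum.cong refl) (simp add: algebra_simps power2_eq_square)
    also have "\<dots> = (\<Sum>k\<le>n. (y k)\<^sup>2 *\<^sub>R F k) - \<beta> * (\<Sum>k\<le>n. y k *\<^sub>R F k)
        - (\<Sum>k\<le>n. y k *\<^sub>R F k) * \<beta> + \<beta> * (\<Sum>k\<le>n. F k) * \<beta>"
      by (simp only: sum.distrib sum_subtractf sum_distrib_left sum_distrib_right)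
    finally show ?thesis unfolding F0 F1 F2 by (simp add: algebra_simps)
  qed
  show ?thesis by (rule positive_elem_limit_scaleR[OF pos]) simp
qed

lemma kadison:
  assumes "selfadjoint c"
  shows "positive_elem (\<Phi> (c * c) - \<Phi> c * \<Phi> c)"
  using kadison_shifted[OF assms map_selfadjoint[OF assms]] by simp

end

section \<open>Localization along the spectrum\<close>

text \<open>
  Differences of consecutive ramps are tents that sum to \<open>1\<close>.  The ramps are replaced by
  polynomials before taking differences, the first and the last one by the constants \<open>1\<close> and
  \<open>0\<close>, so that telescoping keeps the sum exactly equal to \<open>1\<close>.
\<close>

lemma approximate_tent_partition:
  fixes M \<eta> :: real and N :: nat
  assumes M: "M > 0" and N: "N > 0" and \<eta>: "\<eta> > 0"
  obtains f :: "nat \<Rightarrow> real poly" and \<tau> :: "nat \<Rightarrow> real \<Rightarrow> real"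
  where "(\<Sum>i<2*N+1. f i) = 1"
    and "\<And>x. \<bar>x\<bar> \<le> M \<Longrightarrow> (\<Sum>i<2*N+1. \<tau> i x) = 1"
    and "\<And>i x. 0 \<le> \<tau> i x" and "\<And>i x. \<tau> i x \<le> 1"
    and "\<And>i x. i < 2*N+1 \<Longrightarrow> \<bar>x\<bar> \<le> M \<Longrightarrow> \<bar>poly (f i) x - \<tau> i x\<bar> \<le> \<eta>"
    and "\<And>i x. \<tau> i x \<noteq> 0 \<Longrightarrow> \<bar>x - (real i - real N - 1/2) * (M / real N)\<bar> \<le> 3/2 * (M / real N)"
proof -
  define h where "h = M / real N"
  have h: "h > 0" "M = real N * h" using M N by (simp_all add: h_def)
  define ramp where "ramp i x = max 0 (min 1 (x / h + real N + 1 - real i))" for i x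
  define \<tau> where "\<tau> i x = ramp i x - ramp (Suc i) x" for i x
  have "\<exists>s. \<forall>x. \<bar>x\<bar> \<le> M \<longrightarrow> \<bar>ramp i x - poly s x\<bar> < \<eta> / 2" for i
  proof -
    have "continuous_on {-M..M} (ramp i)"
      unfolding ramp_def using h by (intro continuous_intros) auto
    then obtain g where g: "real_polynomial_function g" "\<And>x. x \<in> {-M..M} \<Longrightarrow> \<bar>ramp i x - g x\<bar> < \<eta> / 2"
      using Stone_Weierstrass_real_polynomial_function[of "{-M..M}" "ramp i" "\<eta> / 2"] \<eta> by auto
    from g(1) obtain a n where "g = (\<lambda>x. \<Sum>i\<le>n. a i * x ^ i)"
      unfolding real_polynomial_function_iff_sum by blast
    then have "g = poly (\<Sum>i\<le>n. monom (a i) i)" by (simp add: poly_sum poly_monom fun_eq_iff)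
    with g(2) show ?thesis
      by (intro exI[of _ "\<Sum>i\<le>n. monom (a i) i"]) (auto simp: abs_le_iff)
  qed
  then obtain s0 where s0: "\<And>i x. \<bar>x\<bar> \<le> M \<Longrightarrow> \<bar>ramp i x - poly (s0 i) x\<bar> < \<eta> / 2" by metis
  define s where "s i = (if i = 0 then 1 else if i = 2*N+1 then 0 else s0 i)" for i
  define f where "f i = s i - s (Suc i)" for i
  have ends: "ramp 0 x = 1" "ramp (2*N+1) x = 0" if "\<bar>x\<bar> \<le> M" for x
  proof -
    have "\<bar>x / h\<bar> \<le> real N" using that h by (simp add: field_simps)
    then have "x / h \<le> real N" "- real N \<le> x / h" 
      by (simp_all only: abs_le_iff) linarith
    then show "ramp 0 x = 1" "ramp (2*N+1) x = 0" by (simp_all add: ramp_def)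
  qed
  have s: "\<bar>ramp i x - poly (s i) x\<bar> \<le> \<eta> / 2" if x: "\<bar>x\<bar> \<le> M" for i x
    using ends[OF x] s0[OF x, of i] \<eta> unfolding s_def by auto
  show ?thesis
  proof (rule that[of f \<tau>])
    show "(\<Sum>i<2*N+1. f i) = 1"
      unfolding f_def by (simp only: sum_lessThan_telescope') (simp add: s_def)
    show "(\<Sum>i<2*N+1. \<tau> i x) = 1" if "\<bar>x\<bar> \<le> M" for x
      unfolding \<tau>_def sum_lessThan_telescope'[of "\<lambda>i. ramp i x"] using ends[OF that] by simp
    show "0 \<le> \<tau> i x" "\<tau> i x \<le> 1" for i x
      by (auto simp: \<tau>_def ramp_def)
    show "\<bar>poly (f i) x - \<tau> i x\<bar> \<le> \<eta>" if "\<bar>x\<bar> \<le> M" for i x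
      using s[OF that, of i] s[OF that, of "Suc i"] unfolding f_def \<tau>_def poly_diff by linarith
    show "\<bar>x - (real i - real N - 1/2) * (M / real N)\<bar> \<le> 3/2 * (M / real N)" if "\<tau> i x \<noteq> 0" for i x
    proof -
      define w where "w = x / h + real N + 1 - real i"
      have "\<tau> i x = max 0 (min 1 w) - max 0 (min 1 (w - 1))"
        by (simp add: \<tau>_def ramp_def w_def algebra_simps)
      then have "0 \<le> w" "w \<le> 2" using that by linarith+
      then have "\<bar>x / h - (real i - real N - 1/2)\<bar> \<le> 3/2" unfolding w_def by linarith
      then have "\<bar>x / h - (real i - real N - 1/2)\<bar> * h \<le> 3/2 * h"
        using h by (intro mult_right_mono) simp_all
      then show ?thesis using h(1) by (simp add: abs_mult_pos left_diff_distrib flip: h_def)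
    qed
  qed
qed

text \<open>
  Cut the spectrum of \<open>b\<close> into \<open>m\<close> pieces of length of order \<open>1 / m\<close> by functions
  \<open>f i\<close> with sum \<open>1\<close>.  Pinching gives \<open>X \<le> m (\<Sum>i. f i X f i)\<close>, and on the \<open>i\<close>-th piece
  the bound \<open>X \<le> G \<nu>\<close>, with \<open>\<nu>\<close> in that piece, is of order \<open>1 / m\<^sup>2\<close>; as the \<open>f i\<close>
  commute with \<open>G \<nu>\<close> and are almost orthogonal, so is the sum.  Hence \<open>X\<close> is at most of
  order \<open>1 / m\<close>.  The nodes \<open>\<nu>\<close> are half-integer multiples of the mesh, so that none
  is \<open>0\<close> and each piece lies in the range where \<open>G \<nu>\<close> is controlled.
\<close>

lemma eq_zero_if_locally_quadratically_small:
  fixes X b :: "'a::unital_cstar_algebra" and G :: "real \<Rightarrow> real poly"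
  assumes X: "positive_elem X" and b: "selfadjoint b" and K: "K \<ge> 0"
    and le: "\<And>\<nu>. \<nu> \<noteq> 0 \<Longrightarrow> positive_elem (rpoly_eval (G \<nu>) b - X)"
    and G: "\<And>\<nu> x. \<nu> \<noteq> 0 \<Longrightarrow> \<bar>x - \<nu>\<bar> \<le> 3 * \<bar>\<nu>\<bar> \<Longrightarrow> poly (G \<nu>) x \<le> K * (x - \<nu>)\<^sup>2"
  shows "X = 0"
proof (rule positive_elem_antisym[OF X])
  define M where "M = norm b + 1"
  have M: "M > 0" "norm b \<le> M" by (simp_all add: M_def add_nonneg_pos)
  define C where "C = 3 * (9/2 * K + 1) * M\<^sup>2"
  have "positive_elem (- X + (1 / real N) *\<^sub>R (C *\<^sub>R 1))" if N: "N > 0" for N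
  proof -
    define h where "h = M / real N"
    define m where "m = 2 * N + 1"
    define \<nu> where "\<nu> i = (real i - real N - 1/2) * h" for i
    define A where "A = 9/4 * K * h\<^sup>2"
    have h: "h > 0" using M N by (simp add: h_def)
    have A: "A \<ge> 0" using K by (simp add: A_def)
    have \<nu>: "h \<le> 2 * \<bar>\<nu> i\<bar>" for i
    proof -
      have "1 \<le> 2 * \<bar>real i - real N - 1/2\<bar>" by (cases "i \<le> N") auto
      then have "1 * h \<le> 2 * \<bar>real i - real N - 1/2\<bar> * h" using h by (intro mult_right_mono) simp_all
      then show ?thesis using h by (simp add: \<nu>_def abs_mult)
    qed
    have \<nu>0: "\<nu> i \<noteq> 0" for i using \<nu>[of i] h by auto
    have "\<exists>c. \<forall>x. \<bar>x\<bar> \<le> M \<longrightarrow> poly (G (\<nu> i)) x \<le> c" for i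
    proof -
      have "compact (poly (G (\<nu> i)) ` {-M..M})"
        by (intro compact_continuous_image continuous_intros) simp
      then have "bdd_above (poly (G (\<nu> i)) ` {-M..M})"
        by (intro bounded_imp_bdd_above compact_imp_bounded)
      then obtain c where "\<And>x. x \<in> {-M..M} \<Longrightarrow> poly (G (\<nu> i)) x \<le> c"
        unfolding bdd_above_def by blast
      then show ?thesis by (intro exI[of _ c]) (simp add: abs_le_iff)
    qed
    then obtain \<Gamma>0 where \<Gamma>0: "\<And>i x. \<bar>x\<bar> \<le> M \<Longrightarrow> poly (G (\<nu> i)) x \<le> \<Gamma>0 i" by metis
    define \<Gamma> where "\<Gamma> = (\<Sum>i<m. \<bar>\<Gamma>0 i\<bar>)"
    have \<Gamma>: "poly (G (\<nu> i)) x \<le> \<Gamma>" if "\<bar>x\<bar> \<le> M" "i < m" for i x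
    proof -
      have "\<bar>\<Gamma>0 i\<bar> \<le> \<Gamma>" unfolding \<Gamma>_def using that(2) by (intro member_le_sum) simp_all
      then show ?thesis using \<Gamma>0[OF that(1), of i] by linarith
    qed
    have \<Gamma>_ge0: "\<Gamma> \<ge> 0" by (simp add: \<Gamma>_def sum_nonneg)
    \<comment> \<open>Replacing tents by polynomials costs at most \<open>2 \<eta>\<^sup>2 (A + \<Gamma>)\<close> on each of the
      \<open>m\<close> pieces; \<open>\<eta>\<close> is chosen so that this adds up to at most \<open>h\<^sup>2\<close>.\<close>
    define \<eta> where "\<eta> = h / sqrt (2 * real m * (A + \<Gamma> + 1))"
    have \<eta>: "\<eta> > 0" using h A \<Gamma>_ge0 by (simp add: \<eta>_def m_def)
    have \<eta>2: "real m * (2 * \<eta>\<^sup>2 * (A + \<Gamma>)) \<le> h\<^sup>2"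
    proof -
      have "\<eta>\<^sup>2 = h\<^sup>2 / (2 * real m * (A + \<Gamma> + 1))"
        using A \<Gamma>_ge0 by (simp add: \<eta>_def power_divide)
      moreover have "2 * real m * (A + \<Gamma> + 1) \<noteq> 0" using A \<Gamma>_ge0 by (simp add: m_def)
      ultimately have "\<eta>\<^sup>2 * (2 * real m * (A + \<Gamma> + 1)) = h\<^sup>2"
        by (simp only: times_divide_eq_left nonzero_mult_div_cancel_right not_False_eq_True)
      moreover have "real m * (2 * \<eta>\<^sup>2 * (A + \<Gamma>)) \<le> \<eta>\<^sup>2 * (2 * real m * (A + \<Gamma> + 1))"
        by (simp add: algebra_simps)
      ultimately show ?thesis by simp
    qed
    obtain f \<tau> where f1: "(\<Sum>i<m. f i) = 1"
      and \<tau>1: "\<And>x. \<bar>x\<bar> \<le> M \<Longrightarrow> (\<Sum>i<m. \<tau> i x) = 1"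
      and \<tau>0: "\<And>i x. 0 \<le> \<tau> i x" and \<tau>le: "\<And>i x. \<tau> i x \<le> 1"
      and f\<tau>: "\<And>i x. i < m \<Longrightarrow> \<bar>x\<bar> \<le> M \<Longrightarrow> \<bar>poly (f i) x - \<tau> i x\<bar> \<le> \<eta>"
      and supp: "\<And>i x. \<tau> i x \<noteq> 0 \<Longrightarrow> \<bar>x - \<nu> i\<bar> \<le> 3/2 * h"
      using approximate_tent_partition[OF M(1) N \<eta>] unfolding m_def \<nu>_def h_def by metis
    have piece: "poly (f i) x * poly (G (\<nu> i)) x * poly (f i) x \<le> 2 * A * \<tau> i x + 2 * \<eta>\<^sup>2 * (A + \<Gamma>)"
      if i: "i < m" and x: "\<bar>x\<bar> \<le> M" for i x
    proof (cases "\<tau> i x = 0")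
      case True
      have "(poly (f i) x)\<^sup>2 \<le> \<eta>\<^sup>2" using f\<tau>[OF i x] True \<eta> by (simp add: abs_le_square_iff[symmetric])
      then have "(poly (f i) x)\<^sup>2 * \<Gamma> \<le> \<eta>\<^sup>2 * \<Gamma>" using \<Gamma>_ge0 by (rule mult_right_mono)
      moreover have "(poly (f i) x)\<^sup>2 * poly (G (\<nu> i)) x \<le> (poly (f i) x)\<^sup>2 * \<Gamma>"
        using \<Gamma>[OF x i] by (intro mult_left_mono) simp_all
      moreover have "0 \<le> \<eta>\<^sup>2 * \<Gamma> + 2 * (\<eta>\<^sup>2 * A)" using A \<Gamma>_ge0 by simp
      ultimately show ?thesis using True by (simp add: power2_eq_square algebra_simps)
    next
      case False
      have xn: "\<bar>x - \<nu> i\<bar> \<le> 3/2 * h" using supp[OF False] .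
      have "poly (G (\<nu> i)) x \<le> K * (x - \<nu> i)\<^sup>2"
        using xn \<nu>[of i] by (intro G \<nu>0) linarith
      also have "\<dots> \<le> K * (3/2 * h)\<^sup>2"
        using xn K h by (intro mult_left_mono) (simp_all add: abs_le_square_iff[symmetric])
      finally have GA: "poly (G (\<nu> i)) x \<le> A" by (simp add: A_def power2_eq_square)
      have "(poly (f i) x)\<^sup>2 \<le> 2 * (\<tau> i x)\<^sup>2 + 2 * (poly (f i) x - \<tau> i x)\<^sup>2"
        using sum_squares_ge_zero[of "poly (f i) x - 2 * \<tau> i x" 0]
        by (simp add: power2_eq_square algebra_simps)
      also have "(poly (f i) x - \<tau> i x)\<^sup>2 \<le> \<eta>\<^sup>2"
        using f\<tau>[OF i x] \<eta> by (simp add: abs_le_square_iff[symmetric])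
      also have "(\<tau> i x)\<^sup>2 \<le> \<tau> i x"
        using \<tau>0[of i x] \<tau>le[of i x] by (simp add: power2_eq_square mult_left_le)
      finally have "(poly (f i) x)\<^sup>2 * A \<le> (2 * \<tau> i x + 2 * \<eta>\<^sup>2) * A"
        using A by (intro mult_right_mono) simp_all
      moreover have "(poly (f i) x)\<^sup>2 * poly (G (\<nu> i)) x \<le> (poly (f i) x)\<^sup>2 * A"
        using GA by (intro mult_left_mono) simp_all
      moreover have "0 \<le> \<eta>\<^sup>2 * \<Gamma>" using \<Gamma>_ge0 by simp
      ultimately show ?thesis by (simp add: power2_eq_square algebra_simps)
    qed
    define c where "c = (9/2 * K + 1) * h\<^sup>2"
    define F where "F i = rpoly_eval (f i) b" for i
    have "positive_elem (rpoly_eval ([:c:] - (\<Sum>i<m. f i * G (\<nu> i) * f i)) b)"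
    proof (rule positive_elem_rpoly_eval[OF b M(2)])
      fix x assume x: "\<bar>x\<bar> \<le> M"
      have "poly (\<Sum>i<m. f i * G (\<nu> i) * f i) x \<le> (\<Sum>i<m. 2 * A * \<tau> i x + 2 * \<eta>\<^sup>2 * (A + \<Gamma>))"
        unfolding poly_sum poly_mult using piece x by (intro sum_mono) simp_all
      also have "\<dots> = 2 * A + real m * (2 * \<eta>\<^sup>2 * (A + \<Gamma>))"
        by (simp add: sum.distrib \<tau>1[OF x] flip: sum_distrib_left)
      also have "\<dots> \<le> 2 * A + h\<^sup>2" using \<eta>2 by simp
      also have "\<dots> = c" by (simp add: c_def A_def algebra_simps)
      finally show "0 \<le> poly ([:c:] - (\<Sum>i<m. f i * G (\<nu> i) * f i)) x" by simp
    qed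
    then have 1: "positive_elem (c *\<^sub>R 1 - (\<Sum>i<m. F i * rpoly_eval (G (\<nu> i)) b * F i))"
      by (simp add: rpoly_eval_diff rpoly_eval_sum rpoly_eval_mult F_def)
    have F: "selfadjoint (F i)" for i by (simp add: F_def selfadjoint_rpoly_eval b)
    have "positive_elem (\<Sum>i<m. F i * (rpoly_eval (G (\<nu> i)) b - X) * F i)"
      by (intro positive_elem_sum positive_elem_conj le \<nu>0 F)
    then have 2: "positive_elem ((\<Sum>i<m. F i * rpoly_eval (G (\<nu> i)) b * F i) - (\<Sum>i<m. F i * X * F i))"
      by (simp add: algebra_simps sum_subtractf)
    have "(\<Sum>i<m. F i) = 1" by (simp add: F_def f1 flip: rpoly_eval_sum)
    then have 3: "positive_elem (real m *\<^sub>R (\<Sum>i<m. F i * X * F i) - X)"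
      using X F by (intro positive_elem_pinching)
    have "positive_elem (c *\<^sub>R 1 - (\<Sum>i<m. F i * X * F i))"
      using positive_elem_add[OF 1 2] by simp
    then have "positive_elem (real m *\<^sub>R (c *\<^sub>R 1 - (\<Sum>i<m. F i * X * F i)))"
      by (rule positive_elem_scaleR) simp
    from positive_elem_add[OF this 3] have 4: "positive_elem ((real m * c) *\<^sub>R 1 - X)"
      by (simp add: algebra_simps)
    have "real m * c \<le> C / real N"
    proof -
      have "real m * c \<le> (3 * real N) * c"
        using N K by (intro mult_right_mono) (simp_all add: m_def c_def)
      also have "\<dots> = C / real N" using N by (simp add: c_def C_def h_def power2_eq_square)
      finally show ?thesis .
    qed
    then have "positive_elem ((C / real N - real m * c) *\<^sub>R (1::'a))"
      by (intro positive_elem_scaleR) simp_all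
    from positive_elem_add[OF 4 this] show ?thesis by (simp add: algebra_simps)
  qed
  from this[of "Suc n" for n] show "positive_elem (- X)"
    by (rule positive_elem_limit_scaleR[of "- X" "C *\<^sub>R 1"]) simp
qed

section \<open>The tangent-line polynomial of two exponents\<close>

text \<open>
  In the variable \<open>s = u\<^sup>p\<close> the expression \<open>p u\<^sup>q - q u\<^sup>p + (q - p)\<close> is, up to the
  factor \<open>p\<close>, the convex function \<open>\<bar>s\<bar> powr (q / p)\<close> minus its tangent at \<open>s = 1\<close>; the
  parities of \<open>p\<close> and \<open>q\<close> make this work on the whole real line.  It therefore vanishes
  to exactly second order at \<open>u = 1\<close> and nowhere else.
\<close>

lemma tangent_poly_lower:
  fixes u :: real
  assumes p: "odd p" and q: "even q" and pq: "p < q"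
  shows "(u - 1)\<^sup>2 \<le> 4 * (real p * u ^ q - real q * u ^ p + (real q - real p))"
proof (cases "u \<ge> 0")
  case True
  have mono: "0 \<le> (u - 1) * (u ^ j - u ^ i)" if "i \<le> j" for i j
  proof (cases "u \<ge> 1")
    case True
    then show ?thesis using that by (simp add: power_increasing)
  next
    case False
    then show ?thesis using that \<open>u \<ge> 0\<close>
      by (intro mult_nonpos_nonpos) (simp_all add: power_decreasing)
  qed
  define D where "D k = real p * u ^ k - real k * u ^ p + (real k - real p)" for k
  have D_Suc: "D (Suc k) - D k = (\<Sum>i<p. (u - 1) * (u ^ k - u ^ i))" for k
  proof -
    have "(\<Sum>i<p. (u - 1) * (u ^ k - u ^ i)) = real p * ((u - 1) * u ^ k) - (u - 1) * (\<Sum>i<p. u ^ i)"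
      by (simp add: right_diff_distrib sum_subtractf sum_distrib_left)
    also have "(u - 1) * (\<Sum>i<p. u ^ i) = u ^ p - 1" by (simp add: power_diff_1_eq)
    finally show ?thesis by (simp add: D_def algebra_simps)
  qed
  have "(u - 1)\<^sup>2 \<le> D (Suc p)"
  proof -
    have p0: "p > 0" using p by (rule odd_pos)
    have "(u - 1)\<^sup>2 \<le> (u - 1) * (u ^ p - u ^ 0)"
      using mono[of 1 p] p0 by (simp add: power2_eq_square algebra_simps)
    also have "\<dots> \<le> (\<Sum>i<p. (u - 1) * (u ^ p - u ^ i))"
      using p0 mono by (intro member_le_sum[where f = "\<lambda>i. (u - 1) * (u ^ p - u ^ i)"]) auto
    also have "\<dots> = D (Suc p)" using D_Suc[of p] by (simp add: D_def)
    finally show ?thesis .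
  qed
  also have "D (Suc p) \<le> D q"
  proof -
    have "Suc p \<le> q" using pq by simp
    then show ?thesis
    proof (induction q rule: dec_induct)
      case (step k)
      have "0 \<le> D (Suc k) - D k" unfolding D_Suc using step by (intro sum_nonneg mono) auto
      with step show ?case by simp
    qed simp
  qed
  finally have "(u - 1)\<^sup>2 \<le> D q" .
  then have "(u - 1)\<^sup>2 \<le> 4 * D q"
    using zero_le_power2[of "u - 1"] by linarith
  then show ?thesis by (simp only: D_def)
next
  case False
  define v where "v = - u"
  have v: "v > 0" using False by (simp add: v_def)
  have up: "u ^ p = - (v ^ p)" "u ^ q = v ^ q" using p q by (simp_all add: v_def)
  have pq1: "real q - real p \<ge> 1" "real p \<ge> 1" using pq odd_pos[OF p] by linarith+
  have "(1 + v)\<^sup>2 \<le> 4 * (real p * v ^ q + (real q - real p))"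
  proof (cases "v \<le> 1")
    case True
    have "(1 + v)\<^sup>2 \<le> 2\<^sup>2" using True v by (intro power_mono) simp_all
    moreover have "0 \<le> real p * v ^ q" using v by simp
    ultimately show ?thesis using pq1 by simp
  next
    case False
    have "(1 + v)\<^sup>2 \<le> (2 * v)\<^sup>2" using False by (intro power_mono) simp_all
    moreover have "v ^ 2 \<le> v ^ q" using False q pq by (intro power_increasing) (presburger, simp)
    moreover have "1 * v ^ q \<le> real p * v ^ q" using pq1 v by (intro mult_right_mono) simp_all
    ultimately show ?thesis using pq1 by (simp add: power_mult_distrib)
  qed
  moreover have "0 \<le> real q * v ^ p" using v by simp
  moreover have "(u - 1)\<^sup>2 = (1 + v)\<^sup>2" by (simp add: v_def power2_eq_square algebra_simps)
  ultimately show ?thesis unfolding up by simp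
qed

lemma tangent_poly_upper:
  "\<exists>K\<ge>0. \<forall>u::real. \<bar>u - 1\<bar> \<le> 3 \<longrightarrow> real p * u ^ q - real q * u ^ p + (real q - real p) \<le> K * (u - 1)\<^sup>2"
proof -
  have taylor: "\<exists>K\<ge>0. \<forall>u::real. \<bar>u - 1\<bar> \<le> 3 \<longrightarrow> \<bar>u ^ k - 1 - real k * (u - 1)\<bar> \<le> K * (u - 1)\<^sup>2" for k
  proof (induction k)
    case 0
    show ?case by (intro exI[of _ 0]) simp
  next
    case (Suc k)
    then obtain K where K: "K \<ge> 0"
      "\<And>u::real. \<bar>u - 1\<bar> \<le> 3 \<Longrightarrow> \<bar>u ^ k - 1 - real k * (u - 1)\<bar> \<le> K * (u - 1)\<^sup>2" by auto
    show ?case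
    proof (intro exI[of _ "4 * K + real k"] conjI allI impI)
      fix u :: real assume u: "\<bar>u - 1\<bar> \<le> 3"
      have "u ^ Suc k - 1 - real (Suc k) * (u - 1) = u * (u ^ k - 1 - real k * (u - 1)) + real k * (u - 1)\<^sup>2"
        by (simp add: algebra_simps power2_eq_square)
      also have "\<bar>\<dots>\<bar> \<le> \<bar>u\<bar> * \<bar>u ^ k - 1 - real k * (u - 1)\<bar> + real k * (u - 1)\<^sup>2"
        by (rule order_trans[OF abs_triangle_ineq]) (simp add: abs_mult)
      also have "\<dots> \<le> 4 * (K * (u - 1)\<^sup>2) + real k * (u - 1)\<^sup>2"
        using u K(2)[OF u] by (intro add_right_mono mult_mono) simp_all
      finally show "\<bar>u ^ Suc k - 1 - real (Suc k) * (u - 1)\<bar> \<le> (4 * K + real k) * (u - 1)\<^sup>2"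
        by (simp add: algebra_simps)
    qed (use K in simp)
  qed
  obtain Kp where Kp: "Kp \<ge> 0" "\<And>u::real. \<bar>u - 1\<bar> \<le> 3 \<Longrightarrow> \<bar>u ^ p - 1 - real p * (u - 1)\<bar> \<le> Kp * (u - 1)\<^sup>2"
    using taylor[of p] by auto
  obtain Kq where Kq: "Kq \<ge> 0" "\<And>u::real. \<bar>u - 1\<bar> \<le> 3 \<Longrightarrow> \<bar>u ^ q - 1 - real q * (u - 1)\<bar> \<le> Kq * (u - 1)\<^sup>2"
    using taylor[of q] by auto
  show ?thesis
  proof (intro exI[of _ "real p * Kq + real q * Kp"] conjI allI impI)
    fix u :: real assume u: "\<bar>u - 1\<bar> \<le> 3"
    have "real p * u ^ q - real q * u ^ p + (real q - real p) =
        real p * (u ^ q - 1 - real q * (u - 1)) - real q * (u ^ p - 1 - real p * (u - 1))"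
      by (simp add: algebra_simps)
    also have "\<dots> \<le> real p * \<bar>u ^ q - 1 - real q * (u - 1)\<bar> + real q * \<bar>u ^ p - 1 - real p * (u - 1)\<bar>"
      by (smt (verit) mult_left_mono of_nat_0_le_iff mult_minus_right abs_ge_self abs_ge_minus_self)
    also have "\<dots> \<le> real p * (Kq * (u - 1)\<^sup>2) + real q * (Kp * (u - 1)\<^sup>2)"
      using Kp(2)[OF u] Kq(2)[OF u] by (intro add_mono mult_left_mono) simp_all
    finally show "real p * u ^ q - real q * u ^ p + (real q - real p) \<le> (real p * Kq + real q * Kp) * (u - 1)\<^sup>2"
      by (simp add: algebra_simps)
  qed (use Kp Kq in simp)
qed

text \<open>The expression above at \<open>u = x / \<nu>\<close>, scaled to be comparable with \<open>(x - \<nu>)\<^sup>2\<close>.\<close>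

definition tangent_poly :: "nat \<Rightarrow> nat \<Rightarrow> real \<Rightarrow> real poly" where
  "tangent_poly p q \<nu> = smult (\<nu>\<^sup>2) (smult (real p / \<nu> ^ q) ([:0, 1:] ^ q)
     - smult (real q / \<nu> ^ p) ([:0, 1:] ^ p) + [:real q - real p:])"

lemma poly_tangent_poly:
  "poly (tangent_poly p q \<nu>) x =
     \<nu>\<^sup>2 * (real p * (x / \<nu>) ^ q - real q * (x / \<nu>) ^ p + (real q - real p))"
  by (simp add: tangent_poly_def power_divide)

lemma poly_tangent_poly_ge:
  assumes "odd p" "even q" "p < q" "\<nu> \<noteq> 0"
  shows "(x - \<nu>)\<^sup>2 \<le> 4 * poly (tangent_poly p q \<nu>) x"
proof -
  have "(x - \<nu>)\<^sup>2 = \<nu>\<^sup>2 * (x / \<nu> - 1)\<^sup>2" using assms(4) by (simp add: field_simps power2_eq_square)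
  also have "\<dots> \<le> \<nu>\<^sup>2 * (4 * (real p * (x / \<nu>) ^ q - real q * (x / \<nu>) ^ p + (real q - real p)))"
    using tangent_poly_lower[OF assms(1-3)] by (intro mult_left_mono) simp_all
  finally show ?thesis by (simp only: poly_tangent_poly mult.left_commute)
qed

lemma poly_tangent_poly_le:
  obtains K where "K \<ge> 0"
    "\<And>\<nu> x. \<nu> \<noteq> 0 \<Longrightarrow> \<bar>x - \<nu>\<bar> \<le> 3 * \<bar>\<nu>\<bar> \<Longrightarrow> poly (tangent_poly p q \<nu>) x \<le> K * (x - \<nu>)\<^sup>2"
proof -
  obtain K where K: "K \<ge> 0" "\<And>u::real. \<bar>u - 1\<bar> \<le> 3 \<Longrightarrow>
      real p * u ^ q - real q * u ^ p + (real q - real p) \<le> K * (u - 1)\<^sup>2"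
    using tangent_poly_upper[of p q] by auto
  have "poly (tangent_poly p q \<nu>) x \<le> K * (x - \<nu>)\<^sup>2" if \<nu>: "\<nu> \<noteq> 0" "\<bar>x - \<nu>\<bar> \<le> 3 * \<bar>\<nu>\<bar>" for \<nu> x
  proof -
    have "x / \<nu> - 1 = (x - \<nu>) / \<nu>" using \<nu> by (simp add: diff_divide_distrib)
    then have "\<bar>x / \<nu> - 1\<bar> = \<bar>x - \<nu>\<bar> / \<bar>\<nu>\<bar>" by simp
    then have "\<bar>x / \<nu> - 1\<bar> \<le> 3" using \<nu> by (simp add: divide_le_eq)
    then have "poly (tangent_poly p q \<nu>) x \<le> \<nu>\<^sup>2 * (K * (x / \<nu> - 1)\<^sup>2)"
      unfolding poly_tangent_poly using K(2) by (intro mult_left_mono) simp_all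
    also have "\<dots> = K * (x - \<nu>)\<^sup>2" using \<nu> by (simp add: field_simps power2_eq_square)
    finally show ?thesis .
  qed
  with K(1) show ?thesis using that by blast
qed

section \<open>Two moments determine a unital positive map on one generator\<close>

context unital_positive_map
begin

lemma map_tangent_poly:
  assumes "b ^ p = \<Phi> (a ^ p)" "b ^ q = \<Phi> (a ^ q)"
  shows "\<Phi> (rpoly_eval (tangent_poly p q \<nu>) a) = rpoly_eval (tangent_poly p q \<nu>) b"
  using assms
  by (simp add: tangent_poly_def rpoly_eval_smult rpoly_eval_add rpoly_eval_diff rpoly_eval_power
      map_add map_diff map_scaleR map_one)

text \<open>
  The element \<open>X = \<Phi> (a\<^sup>2) - b \<Phi> a - (\<Phi> a) b + b\<^sup>2\<close> is the sum of the positive elements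
  \<open>\<Phi> (a\<^sup>2) - (\<Phi> a)\<^sup>2\<close> and \<open>(\<Phi> a - b)\<^sup>2\<close>, so it suffices that \<open>X = 0\<close>.  It
  is invariant under a common real shift of \<open>a\<close> and \<open>b\<close>, hence
  \<open>X \<le> 2 \<Phi> ((a - \<nu>)\<^sup>2) + 2 (b - \<nu>)\<^sup>2\<close> for all \<open>\<nu>\<close>.  The tangent-line
  polynomial dominates \<open>(x - \<nu>)\<^sup>2\<close> and involves only the exponents \<open>0\<close>, \<open>p\<close>,
  \<open>q\<close>, for which \<open>\<Phi>\<close> replaces \<open>a\<close> by \<open>b\<close>; so \<open>X\<close> is bounded by a polynomial in
  \<open>b\<close> vanishing to second order at \<open>\<nu>\<close>.
\<close>

lemma two_moments_determine:
  assumes a: "selfadjoint a" and b: "selfadjoint b"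
    and pq: "odd p" "even q" "p < q"
    and mom: "b ^ p = \<Phi> (a ^ p)" "b ^ q = \<Phi> (a ^ q)"
  shows "\<Phi> a = b" and "\<Phi> (a * a) = \<Phi> a * \<Phi> a"
proof -
  define X where "X = \<Phi> (a * a) - b * \<Phi> a - \<Phi> a * b + b * b"
  obtain K where K: "K \<ge> 0"
    "\<And>\<nu> x. \<nu> \<noteq> 0 \<Longrightarrow> \<bar>x - \<nu>\<bar> \<le> 3 * \<bar>\<nu>\<bar> \<Longrightarrow> poly (tangent_poly p q \<nu>) x \<le> K * (x - \<nu>)\<^sup>2"
    using poly_tangent_poly_le[of p q] by blast
  define G where "G \<nu> = smult 8 (tangent_poly p q \<nu>) + smult 2 ([:- \<nu>, 1:] * [:- \<nu>, 1:])" for \<nu>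
  have "X = 0"
  proof (rule eq_zero_if_locally_quadratically_small[where G = G and K = "8 * K + 2"])
    show "positive_elem X" unfolding X_def by (rule kadison_shifted[OF a b])
    show "poly (G \<nu>) x \<le> (8 * K + 2) * (x - \<nu>)\<^sup>2" if "\<nu> \<noteq> 0" "\<bar>x - \<nu>\<bar> \<le> 3 * \<bar>\<nu>\<bar>" for \<nu> x
    proof -
      have "poly (G \<nu>) x = 8 * poly (tangent_poly p q \<nu>) x + 2 * (x - \<nu>)\<^sup>2"
        by (simp add: G_def power2_eq_square algebra_simps)
      then show ?thesis using K(2)[OF that] by (simp add: algebra_simps)
    qed
    show "positive_elem (rpoly_eval (G \<nu>) b - X)" if \<nu>: "\<nu> \<noteq> 0" for \<nu>
    proof -
      define c where "c = a - \<nu> *\<^sub>R 1"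
      define \<beta> where "\<beta> = b - \<nu> *\<^sub>R 1"
      define T where "T = rpoly_eval (tangent_poly p q \<nu>) b"
      have "positive_elem (rpoly_eval (smult 4 (tangent_poly p q \<nu>) - [:- \<nu>, 1:] * [:- \<nu>, 1:]) a)"
        using poly_tangent_poly_ge[OF pq \<nu>]
        by (intro positive_elem_rpoly_eval[OF a order_refl])
          (simp add: power2_eq_square algebra_simps)
      then have "positive_elem (\<Phi> (rpoly_eval (smult 4 (tangent_poly p q \<nu>)
          - [:- \<nu>, 1:] * [:- \<nu>, 1:]) a))" by (rule map_positive)
      moreover have "rpoly_eval (smult 4 (tangent_poly p q \<nu>) - [:- \<nu>, 1:] * [:- \<nu>, 1:]) a
          = 4 *\<^sub>R rpoly_eval (tangent_poly p q \<nu>) a - c * c"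
        unfolding rpoly_eval_diff rpoly_eval_smult rpoly_eval_mult by (simp add: c_def)
      ultimately have "positive_elem (4 *\<^sub>R T - \<Phi> (c * c))"
        by (simp only: map_diff map_scaleR map_tangent_poly[OF mom] T_def)
      then have 1: "positive_elem (2 *\<^sub>R (4 *\<^sub>R T - \<Phi> (c * c)))"
        by (rule positive_elem_scaleR) simp
      \<comment> \<open>Reversing the sign of \<open>\<beta>\<close> in \<open>X\<close> gives another positive element, and the
        two add up to \<open>2 \<Phi> (c\<^sup>2) + 2 \<beta>\<^sup>2\<close>.\<close>
      have "positive_elem (\<Phi> (c * c) - (- \<beta>) * \<Phi> c - \<Phi> c * (- \<beta>) + (- \<beta>) * (- \<beta>))"
        using a b by (intro kadison_shifted) (simp_all add: c_def \<beta>_def)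
      then have 2: "positive_elem (\<Phi> (c * c) + \<beta> * \<Phi> c + \<Phi> c * \<beta> + \<beta> * \<beta>)" by simp
      have X: "X = \<Phi> (c * c) - \<beta> * \<Phi> c - \<Phi> c * \<beta> + \<beta> * \<beta>"
        by (simp add: X_def c_def \<beta>_def map_add map_diff map_scaleR map_one algebra_simps)
      have "rpoly_eval (G \<nu>) b = 8 *\<^sub>R T + 2 *\<^sub>R (\<beta> * \<beta>)"
        unfolding G_def rpoly_eval_add rpoly_eval_smult rpoly_eval_mult by (simp add: T_def \<beta>_def)
      then have "rpoly_eval (G \<nu>) b - X = 2 *\<^sub>R (4 *\<^sub>R T - \<Phi> (c * c))
          + (\<Phi> (c * c) + \<beta> * \<Phi> c + \<Phi> c * \<beta> + \<beta> * \<beta>)"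
        unfolding X by (simp add: algebra_simps scaleR_2)
      with positive_elem_add[OF 1 2] show ?thesis by simp
    qed
  qed (use b K in simp_all)
  define Y where "Y = \<Phi> (a * a) - \<Phi> a * \<Phi> a"
  define Z where "Z = (\<Phi> a - b) * (\<Phi> a - b)"
  have sZ: "selfadjoint (\<Phi> a - b)" using a b map_selfadjoint by simp
  have Y: "positive_elem Y" unfolding Y_def by (rule kadison[OF a])
  have Z: "positive_elem Z" unfolding Z_def by (rule positive_elem_square[OF sZ])
  have YZ: "Y + Z = 0" using \<open>X = 0\<close> by (simp add: X_def Y_def Z_def algebra_simps)
  then have "Z = - Y" "Y = - Z" by (simp_all add: eq_neg_iff_add_eq_0 add.commute)
  then have Y0: "Y = 0" and Z0: "Z = 0" using Y Z positive_elem_antisym by metis+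
  have "(norm (\<Phi> a - b))\<^sup>2 = 0"
    using norm_selfadjoint_square[OF sZ] Z0 by (simp add: Z_def)
  then show "\<Phi> a = b" by simp
  show "\<Phi> (a * a) = \<Phi> a * \<Phi> a" using Y0 by (simp add: Y_def)
qed

text \<open>
  The defect \<open>\<Phi> (x\<^sup>2) - (\<Phi> x)\<^sup>2\<close> is nonnegative and vanishes at \<open>x = a\<close>; so its
  first variation there in the direction \<open>a ^ m\<close>, which is twice
  \<open>\<Phi> (a ^ Suc m) - \<Phi> a * \<Phi> (a ^ m)\<close> once \<open>\<Phi> (a ^ m) = \<Phi> a ^ m\<close>, must vanish.
\<close>

lemma map_power_if_map_square:
  assumes a: "selfadjoint a" and sq: "\<Phi> (a * a) = \<Phi> a * \<Phi> a"
  shows "\<Phi> (a ^ n) = \<Phi> a ^ n"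
proof (induction n)
  case (Suc m)
  define c where "c = a ^ m"
  define d where "d = \<Phi> c"
  define W where "W = \<Phi> (a ^ Suc m) - \<Phi> a ^ Suc m"
  have ac: "a * c = a ^ Suc m" "c * a = a ^ Suc m" by (simp_all add: c_def power_commutes)
  have bd: "\<Phi> a * d = \<Phi> a ^ Suc m" "d * \<Phi> a = \<Phi> a ^ Suc m"
    using Suc by (simp_all add: c_def d_def power_commutes)
  have sc: "selfadjoint c" using a by (simp add: c_def)
  have expand: "\<Phi> ((a + t *\<^sub>R c) * (a + t *\<^sub>R c)) - \<Phi> (a + t *\<^sub>R c) * \<Phi> (a + t *\<^sub>R c)
      = (2 * t) *\<^sub>R W + t\<^sup>2 *\<^sub>R (\<Phi> (c * c) - d * d)" for t
  proof -
    have "(a + t *\<^sub>R c) * (a + t *\<^sub>R c) = a * a + (2 * t) *\<^sub>R a ^ Suc m + t\<^sup>2 *\<^sub>R (c * c)"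
      by (simp add: distrib_left distrib_right ac power2_eq_square scaleR_2 flip: scaleR_scaleR
          del: power_Suc) (simp add: algebra_simps)
    moreover have "(\<Phi> a + t *\<^sub>R d) * (\<Phi> a + t *\<^sub>R d) =
        \<Phi> a * \<Phi> a + (2 * t) *\<^sub>R \<Phi> a ^ Suc m + t\<^sup>2 *\<^sub>R (d * d)"
      by (simp add: distrib_left distrib_right bd power2_eq_square scaleR_2 flip: scaleR_scaleR
          del: power_Suc) (simp add: algebra_simps)
    ultimately show ?thesis
      by (simp only: map_add map_scaleR sq d_def[symmetric] W_def) (simp add: algebra_simps)
  qed
  have "positive_elem (s *\<^sub>R W)" if s: "s = 1 \<or> s = -1" for s
  proof (rule positive_elem_limit_scaleR)
    fix n :: nat
    \<comment> \<open>Dividing the expansion by \<open>2 \<bar>t\<bar>\<close> leaves \<open>s W\<close> with an error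
      of order \<open>\<bar>t\<bar>\<close>; this \<open>t\<close> makes the error coefficient exactly \<open>1 / (n + 1)\<close>.\<close>
    define t where "t = s * (2 / real (Suc n))"
    have "positive_elem ((2 * t) *\<^sub>R W + t\<^sup>2 *\<^sub>R (\<Phi> (c * c) - d * d))"
      using kadison[of "a + t *\<^sub>R c"] a sc unfolding expand by simp
    then have "positive_elem ((real (Suc n) / 4) *\<^sub>R ((2 * t) *\<^sub>R W + t\<^sup>2 *\<^sub>R (\<Phi> (c * c) - d * d)))"
      by (rule positive_elem_scaleR) simp
    moreover have "real (Suc n) / 4 * (2 * t) = s" by (simp add: t_def)
    moreover have "real (Suc n) / 4 * t\<^sup>2 = 1 / real (Suc n)"
      using s by (auto simp: t_def power2_eq_square)
    ultimately show "positive_elem (s *\<^sub>R W + (1 / real (Suc n)) *\<^sub>R (\<Phi> (c * c) - d * d))"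
      by (simp only: scaleR_add_right scaleR_scaleR)
  qed
  from this[of 1] this[of "-1"] have "W = 0" by (intro positive_elem_antisym) simp_all
  then show ?case by (simp add: W_def)
qed (simp add: map_one)

lemma power_mult_cpoly_eval_pCons:
  "x ^ n * cpoly_eval (pCons c r) x = c *\<^sub>C x ^ n + x ^ Suc n * cpoly_eval r x"
  by (simp add: distrib_left mult_scaleC_right mult.assoc[symmetric] power_commutes)

lemma map_cpoly_eval:
  assumes pow: "\<And>n. \<Phi> (a ^ n) = \<Phi> a ^ n"
  shows "\<Phi> (cpoly_eval r a) = cpoly_eval r (\<Phi> a)"
proof -
  have "\<Phi> (a ^ n * cpoly_eval r a) = \<Phi> a ^ n * cpoly_eval r (\<Phi> a)" for n
  proof (induction r arbitrary: n)
    case (pCons c r)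
    then show ?case using pCons.IH[of "Suc n"]
      by (simp only: power_mult_cpoly_eval_pCons map_add map_scaleC pow)
  qed (simp add: map_zero)
  from this[of 0] show ?thesis by simp
qed

end

lemma hull_singleton_subset_polynomials:
  "unital_subalgebra hull {a} \<subseteq> range (\<lambda>r. cpoly_eval r a)"
proof (rule hull_minimal)
  have "cpoly_eval [:0, 1:] a = a" by (simp add: scaleC_one)
  then show "{a} \<subseteq> range (\<lambda>r. cpoly_eval r a)" by (metis empty_subsetI insert_subset rangeI)
  show "unital_subalgebra (range (\<lambda>r. cpoly_eval r a))"
    unfolding unital_subalgebra_def
  proof (intro conjI ballI allI)
    show "1 \<in> range (\<lambda>r. cpoly_eval r a)" by (metis cpoly_eval_1 rangeI)
  qed (auto simp flip: cpoly_eval_add cpoly_eval_mult cpoly_eval_smult)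
qed

lemma power_in_hull_singleton: "a ^ n \<in> unital_subalgebra hull {a}"
proof -
  have "a ^ n \<in> S" if "unital_subalgebra S" "a \<in> S" for S
    using that by (induction n) (auto simp: unital_subalgebra_def)
  then show ?thesis by (auto simp: hull_def)
qed

theorem theorem1p8:
  fixes \<Phi> :: "'a::unital_cstar_algebra \<Rightarrow> 'b::unital_cstar_algebra"
    and a :: 'a and p q :: nat
  assumes "clinear \<Phi>" and "unital_map \<Phi>" and "positive_map \<Phi>"
    and "selfadjoint a"
    and "0 < p" and "0 < q" and "p < q" and "odd p" and "even q"
  shows "(multiplicative_on (unital_subalgebra hull {a}) \<Phi> \<longleftrightarrow>
            (\<exists>b. selfadjoint b \<and> (\<forall>k\<in>{p, q}. b ^ k = \<Phi> (a ^ k)))) \<and>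
         (\<forall>b. selfadjoint b \<and> (\<forall>k\<in>{p, q}. b ^ k = \<Phi> (a ^ k)) \<longrightarrow> b = \<Phi> a)"
proof -
  interpret unital_positive_map \<Phi> using assms(1-3) by (rule unital_positive_map.intro)
  have moments: "\<Phi> a = b \<and> \<Phi> (a * a) = \<Phi> a * \<Phi> a"
    if "selfadjoint b" "\<forall>k\<in>{p, q}. b ^ k = \<Phi> (a ^ k)" for b
    using two_moments_determine[OF assms(4) that(1) assms(8,9,7)] that(2) by simp
  have "\<Phi> a ^ k = \<Phi> (a ^ k)" if "multiplicative_on (unital_subalgebra hull {a}) \<Phi>" for k
  proof (induction k)
    case (Suc k)
    have "\<Phi> (a * a ^ k) = \<Phi> a * \<Phi> (a ^ k)"
      using that power_in_hull_singleton[of a 1] power_in_hull_singleton[of a k]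
      by (simp add: multiplicative_on_def)
    then show ?case by (simp add: Suc)
  qed (simp add: map_one)
  then have forward: "\<exists>b. selfadjoint b \<and> (\<forall>k\<in>{p, q}. b ^ k = \<Phi> (a ^ k))"
    if "multiplicative_on (unital_subalgebra hull {a}) \<Phi>"
    using that assms(4) map_selfadjoint by blast
  have backward: "multiplicative_on (unital_subalgebra hull {a}) \<Phi>"
    if b: "selfadjoint b" "\<forall>k\<in>{p, q}. b ^ k = \<Phi> (a ^ k)" for b
  proof -
    have "\<Phi> (a ^ n) = \<Phi> a ^ n" for n
      using map_power_if_map_square[OF assms(4)] moments[OF b] by blast
    from map_cpoly_eval[OF this]
    have "\<Phi> (cpoly_eval r a * cpoly_eval s a) = \<Phi> (cpoly_eval r a) * \<Phi> (cpoly_eval s a)" for r s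
      by (metis cpoly_eval_mult)
    then show ?thesis
      unfolding multiplicative_on_def using hull_singleton_subset_polynomials[of a] by blast
  qed
  show ?thesis using forward backward moments by blast
qed

end
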